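(* Let $2\leq r\leq\infty$ and let $\phi:\mathbb{F}_r\to\mathbb{C}$ be a radial function. The following are equivalent. (1) The function $\phi$ is positive definite. (2) There is a finite positive Borel measure $\mu$ on $[-1,1]$ such that $$\phi(x)=\int_{-1}^1\phi_s(x)\,d\mu(s),\qquad x\in\mathbb{F}_r,$$ where $\phi_s$ denotes the spherical function on $\mathbb{F}_r$ with eigenvalue $s$. Moreover, if (2) holds, then $\mu$ is uniquely determined by $\phi$, and $\phi(e)=\mu([-1,1])$.
   Context: For $2\leq r\leq\infty$, $\mathbb{F}_r$ is the free group on $r$ generators (countably infinitely many if $r=\infty$), $e$ is its identity, and $|x|$ is the word length of $x\in\mathbb{F}_r$ with respect to the free generators. A function $\phi:\mathbb{F}_r\to\mathbb{C}$ is radial if $\phi(x)$ depends only on $|x|$; then $\phi(x)=\dot\phi(|x|)$ for a unique $\dot\phi:\mathbb{N}_0\to\mathbb{C}$. Spherical functions: for $s\in\mathbb{C}$, the spherical function $\phi_s$ on $\mathbb{F}_r$ with eigenvalue $s$ is the radial function defined as follows. If $r<\infty$, put $q=2r-1$; then $\phi_s$ is the unique radial function with $\phi_s(e)=1$ such that for every $x$ the average of $\phi_s$ over the $q+1$ neighbours of $x$ in the Cayley graph of $\mathbb{F}_r$ (with respect to the free generators) equals $s\phi_s(x)$. Equivalently, $\dot\phi_s(0)=1$, $\dot\phi_s(1)=s$, and $\dot\phi_s(n+1)=\frac{q+1}{q}s\,\dot\phi_s(n)-\frac1q\dot\phi_s(n-1)$ for $n\geq1$; explicitly, $$\dot\phi_s(n)=\left[\frac{2}{q+1}T_n\left(\frac{q+1}{2\sqrt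 q}s\right)+\frac{q-1}{q+1}U_n\left(\frac{q+1}{2\sqrt q}s\right)\right]q^{-n/2},\qquad n\in\mathbb{N}_0,$$ where $T_n$, $U_n$ are the Chebyshev polynomials of the first and second kind. If $r=\infty$, then $\phi_s(x)=s^{|x|}$ (with $0^0=1$). A map $\phi:G\to\mathbb{C}$ on a group $G$ is positive definite if $\sum_{j,k=1}^n c_j\overline{c_k}\,\phi(x_k^{-1}x_j)\geq0$ for all $n\in\mathbb{N}$, $x_1,\dots,x_n\in G$ and $c_1,\dots,c_n\in\mathbb{C}$. *)

theory Defs
  imports "HOL-Analysis.Analysis" "HOL-Algebra.Group"
begin

section \<open>Positive definite functions\<close>

definition positive_definite :: "('g, 'm) monoid_scheme \<Rightarrow> ('g \<Rightarrow> complex) \<Rightarrow> bool" where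
  "positive_definite G \<phi> \<longleftrightarrow>
     (\<forall>(n::nat) (x :: nat \<Rightarrow> 'g) (c :: nat \<Rightarrow> complex). (\<forall>j<n. x j \<in> carrier G) \<longrightarrow>
        (\<Sum>j<n. \<Sum>k<n. c j * cnj (c k) * \<phi> (inv\<^bsub>G\<^esub> (x k) \<otimes>\<^bsub>G\<^esub> x j)) \<in> \<real>\<^sub>\<ge>\<^sub>0)"


section \<open>The free group of rank r\<close>

text \<open>
  The free generators are the natural numbers \<open>i\<close> with \<open>enat i < r\<close>. A letter \<open>(i, b)\<close> stands for
  the generator \<open>i\<close> if \<open>b\<close> holds and for its inverse otherwise. Group elements are reduced words,
  so the word length of an element with respect to the free generators is its \<open>length\<close> as a list.
\<close>

type_synonym letter = "nat \<times> bool"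
type_synonym word = "letter list"

definition inv_letter :: "letter \<Rightarrow> letter" where
  "inv_letter a = (fst a, \<not> snd a)"

definition letters :: "enat \<Rightarrow> letter set" where
  "letters r = {i. enat i < r} \<times> UNIV"

definition reduced_word :: "word \<Rightarrow> bool" where
  "reduced_word w \<longleftrightarrow> successively (\<lambda>a b. b \<noteq> inv_letter a) w"

fun cancel_cons :: "letter \<Rightarrow> word \<Rightarrow> word" where
  "cancel_cons a [] = [a]"
| "cancel_cons a (b # w) = (if b = inv_letter a then w else a # b # w)"

definition free_group :: "enat \<Rightarrow> word monoid" where
  "free_group r = \<lparr>carrier = {w. set w \<subseteq> letters r \<and> reduced_word w},
                   monoid.mult = foldr cancel_cons, one = []\<rparr>"

lemma inv_letter_invol [simp]: "inv_letter (inv_letter a) = a"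
  by (simp add: inv_letter_def)

lemma inv_letter_neq [simp]: "inv_letter a \<noteq> a" "a \<noteq> inv_letter a"
  by (auto simp: inv_letter_def prod_eq_iff)

lemma inv_letter_swap: "b = inv_letter a \<longleftrightarrow> a = inv_letter b"
  by (metis inv_letter_invol)

lemma inv_letter_in [simp]: "inv_letter a \<in> letters r \<longleftrightarrow> a \<in> letters r"
  by (auto simp: inv_letter_def letters_def mem_Times_iff)

lemma carrier_free_group: "w \<in> carrier (free_group r) \<longleftrightarrow> set w \<subseteq> letters r \<and> reduced_word w"
  by (simp add: free_group_def)

lemma mult_free_group: "u \<otimes>\<^bsub>free_group r\<^esub> v = foldr cancel_cons u v"
  by (simp add: free_group_def)

lemma one_free_group: "\<one>\<^bsub>free_group r\<^esub> = []"
  by (simp add: free_group_def)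

lemma reduced_simps [simp]:
  "reduced_word []" "reduced_word [a]"
  "reduced_word (a # b # w) \<longleftrightarrow> b \<noteq> inv_letter a \<and> reduced_word (b # w)"
  by (auto simp: reduced_word_def)

lemma reduced_tl: "reduced_word (a # w) \<Longrightarrow> reduced_word w"
  by (cases w) auto

lemma reduced_append_iff:
  "reduced_word (u @ v) \<longleftrightarrow>
     reduced_word u \<and> reduced_word v \<and> (u = [] \<or> v = [] \<or> hd v \<noteq> inv_letter (last u))"
  by (auto simp: reduced_word_def successively_append_iff)

lemma reduced_cancel_cons: "reduced_word w \<Longrightarrow> reduced_word (cancel_cons a w)"
  by (cases w) (auto dest: reduced_tl)

lemma reduced_foldr: "reduced_word w \<Longrightarrow> reduced_word (foldr cancel_cons u w)"
  by (induction u) (auto intro: reduced_cancel_cons)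

lemma set_foldr_cancel: "set (foldr cancel_cons u w) \<subseteq> set u \<union> set w"
proof (induction u)
  case (Cons a u)
  have "set (cancel_cons a v) \<subseteq> insert a (set v)" for v
    by (cases v) auto
  with Cons show ?case by fastforce
qed simp

lemma cancel_cons_inv: "reduced_word w \<Longrightarrow> cancel_cons a (cancel_cons (inv_letter a) w) = w"
  by (cases w; cases "tl w") (auto simp: inv_letter_swap)

lemma foldr_cancel_cons:
  assumes "reduced_word w"
  shows "foldr cancel_cons (cancel_cons a v) w = cancel_cons a (foldr cancel_cons v w)"
  using cancel_cons_inv[OF reduced_foldr[OF assms]] by (cases v) auto

lemma foldr_cancel_assoc:
  "reduced_word w \<Longrightarrow> foldr cancel_cons (foldr cancel_cons u v) w
     = foldr cancel_cons u (foldr cancel_cons v w)"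
  by (induction u) (auto simp: foldr_cancel_cons)

lemma foldr_cancel_reduced: "reduced_word (u @ v) \<Longrightarrow> foldr cancel_cons u v = u @ v"
proof (induction u)
  case (Cons a u)
  then have "foldr cancel_cons u v = u @ v"
    using reduced_tl by auto
  with Cons.prems show ?case
    by (cases "u @ v") auto
qed simp

lemma foldr_cancel_left_inv:
  "foldr cancel_cons (map inv_letter (rev u)) u = []"
  by (induction u) auto

lemma reduced_inverse:
  assumes "reduced_word u" shows "reduced_word (map inv_letter (rev u))"
proof -
  have "successively (\<lambda>a b. inv_letter a \<noteq> inv_letter (inv_letter b)) u"
    using assms unfolding reduced_word_def
    by (rule successively_mono) (metis inv_letter_invol)
  then show ?thesis
    by (simp add: reduced_word_def successively_map)
qed

lemma group_free_group: "group (free_group r)"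
proof (rule groupI)
  fix x y assume "x \<in> carrier (free_group r)" "y \<in> carrier (free_group r)"
  then show "x \<otimes>\<^bsub>free_group r\<^esub> y \<in> carrier (free_group r)"
    using set_foldr_cancel[of x y] reduced_foldr[of y x]
    by (auto simp: carrier_free_group mult_free_group)
next
  fix x assume x: "x \<in> carrier (free_group r)"
  show "\<exists>y\<in>carrier (free_group r). y \<otimes>\<^bsub>free_group r\<^esub> x = \<one>\<^bsub>free_group r\<^esub>"
    using x foldr_cancel_left_inv[of x] reduced_inverse[of x]
    by (intro bexI[of _ "map inv_letter (rev x)"])
       (auto simp: carrier_free_group mult_free_group one_free_group)
qed (auto simp: carrier_free_group mult_free_group one_free_group foldr_cancel_assoc)


section \<open>Radial and spherical functions\<close>

definition radial :: "enat \<Rightarrow> (word \<Rightarrow> complex) \<Rightarrow> bool" where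
  "radial r \<phi> \<longleftrightarrow>
     (\<forall>x\<in>carrier (free_group r). \<forall>y\<in>carrier (free_group r). length x = length y \<longrightarrow> \<phi> x = \<phi> y)"

definition neighbours :: "enat \<Rightarrow> word \<Rightarrow> word set" where
  "neighbours r x = (\<lambda>a. x \<otimes>\<^bsub>free_group r\<^esub> [a]) ` letters r"

text \<open>For finite \<open>r\<close>: the defining property of the spherical function with eigenvalue \<open>s\<close>.\<close>

definition is_spherical :: "enat \<Rightarrow> complex \<Rightarrow> (word \<Rightarrow> complex) \<Rightarrow> bool" where
  "is_spherical r s \<phi> \<longleftrightarrow>
     radial r \<phi> \<and> \<phi> \<one>\<^bsub>free_group r\<^esub> = 1 \<and>
     (\<forall>x\<in>carrier (free_group r).
        (\<Sum>y\<in>neighbours r x. \<phi> y) / of_nat (card (neighbours r x)) = s * \<phi> x)"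

text \<open>
  Functions on the free group are represented by functions on all words. Restricting to
  \<open>extensional\<close> ones makes the description below unique; lemmas \<open>is_spherical_spherical\<close> and
  \<open>is_spherical_unique\<close> show that it is well defined.
\<close>

definition spherical :: "enat \<Rightarrow> complex \<Rightarrow> word \<Rightarrow> complex" where
  "spherical r s =
     (if r = \<infinity> then (\<lambda>x. s ^ length x)
      else (THE \<phi>. \<phi> \<in> extensional (carrier (free_group r)) \<and> is_spherical r s \<phi>))"

lemma letters_enat: "letters (enat m) = {..<m} \<times> UNIV"
  by (auto simp: letters_def)

lemma finite_letters: "finite (letters (enat m))"
  by (simp add: letters_enat)

lemma card_letters: "card (letters (enat m)) = 2 * m"
  by (simp add: letters_enat card_cartesian_product)

lemma mult_letter_snoc:
  assumes "reduced_word (y @ [b])"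
  shows "foldr cancel_cons (y @ [b]) [a] = (if a = inv_letter b then y else y @ [b, a])"
proof -
  have "reduced_word y" "reduced_word (y @ [b, a])" if "a \<noteq> inv_letter b"
    using assms that by (auto simp: reduced_append_iff)
  moreover have "reduced_word y"
    using assms by (simp add: reduced_append_iff)
  ultimately show ?thesis
    using foldr_cancel_reduced[of y "[]"] foldr_cancel_reduced[of y "[b, a]"] by simp
qed

lemma inj_on_mult_letter:
  assumes "reduced_word x" shows "inj (\<lambda>a. foldr cancel_cons x [a])"
proof (rule injI)
  fix a c assume eq: "foldr cancel_cons x [a] = foldr cancel_cons x [c]"
  show "a = c"
  proof (cases x rule: rev_cases)
    case (snoc y b)
    show ?thesis
      using eq assms unfolding snoc by (simp add: mult_letter_snoc del: foldr_append split: if_splits)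
  qed (use eq in simp)
qed

lemma card_neighbours:
  assumes "x \<in> carrier (free_group (enat m))"
  shows "card (neighbours (enat m) x) = 2 * m"
  using assms inj_on_mult_letter[of x]
  by (simp add: neighbours_def mult_free_group carrier_free_group card_image card_letters
      inj_on_subset[of _ UNIV])

lemma sum_neighbours:
  assumes x: "x \<in> carrier (free_group (enat m))"
    and f: "\<And>y. y \<in> carrier (free_group (enat m)) \<Longrightarrow> \<phi> y = (f (length y) :: complex)"
  shows "(\<Sum>y\<in>neighbours (enat m) x. \<phi> y) =
    (if x = [] then of_nat (2 * m) * f 1
     else f (length x - 1) + of_nat (2 * m - 1) * f (length x + 1))"
proof -
  interpret group "free_group (enat m)" by (rule group_free_group)
  have red: "reduced_word x" and sub: "set x \<subseteq> letters (enat m)"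
    using x by (auto simp: carrier_free_group)
  have "(\<Sum>y\<in>neighbours (enat m) x. \<phi> y) = (\<Sum>a\<in>letters (enat m). \<phi> (foldr cancel_cons x [a]))"
    unfolding neighbours_def mult_free_group
    using inj_on_mult_letter[OF red] by (subst sum.reindex) (auto intro: inj_on_subset)
  also have "\<dots> = (\<Sum>a\<in>letters (enat m). f (length (foldr cancel_cons x [a])))"
  proof (intro sum.cong refl f)
    fix a assume "a \<in> letters (enat m)"
    then have "[a] \<in> carrier (free_group (enat m))" by (simp add: carrier_free_group)
    from m_closed[OF x this] show "foldr cancel_cons x [a] \<in> carrier (free_group (enat m))"
      by (simp add: mult_free_group)
  qed
  also have "\<dots> = (if x = [] then of_nat (2 * m) * f 1
     else f (length x - 1) + of_nat (2 * m - 1) * f (length x + 1))"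
  proof (cases x rule: rev_cases)
    case Nil
    then show ?thesis by (simp add: card_letters)
  next
    case (snoc y b)
    have b: "inv_letter b \<in> letters (enat m)" using sub snoc by auto
    have "(\<Sum>a\<in>letters (enat m). f (length (foldr cancel_cons x [a])))
        = (\<Sum>a\<in>letters (enat m). if a = inv_letter b then f (length x - 1) else f (length x + 1))"
      using red snoc by (intro sum.cong refl) (auto simp: mult_letter_snoc simp del: foldr_append)
    also have "\<dots> = f (length x - 1) + (\<Sum>a\<in>letters (enat m) - {inv_letter b}. f (length x + 1))"
      by (subst sum.remove[OF finite_letters b]) (auto intro!: sum.cong)
    finally show ?thesis
      using snoc b by (simp add: card_Diff_singleton card_letters)
  qed
  finally show ?thesis .
qed

text \<open>The radial profile of the spherical function, with \<open>q = 2 * m - 1\<close>.\<close>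

fun spherical_profile :: "nat \<Rightarrow> complex \<Rightarrow> nat \<Rightarrow> complex" where
  "spherical_profile m s 0 = 1"
| "spherical_profile m s (Suc 0) = s"
| "spherical_profile m s (Suc (Suc n)) =
     (of_nat (2 * m) * s * spherical_profile m s (Suc n) - spherical_profile m s n)
       / of_nat (2 * m - 1)"

lemma is_spherical_cong:
  assumes m: "1 \<le> m"
    and f: "\<And>y. y \<in> carrier (free_group (enat m)) \<Longrightarrow> \<phi> y = spherical_profile m s (length y)"
  shows "is_spherical (enat m) s \<phi>"
  unfolding is_spherical_def
proof (intro conjI ballI)
  show "radial (enat m) \<phi>" by (simp add: radial_def f)
  show "\<phi> \<one>\<^bsub>free_group (enat m)\<^esub> = 1" by (simp add: f one_free_group carrier_free_group)
  fix x assume x: "x \<in> carrier (free_group (enat m))"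
  have q: "of_nat (2 * m - 1) \<noteq> (0 :: complex)" "of_nat (2 * m) \<noteq> (0 :: complex)"
    using m unfolding of_nat_eq_0_iff by auto
  have sum: "(\<Sum>y\<in>neighbours (enat m) x. \<phi> y) =
    (if x = [] then of_nat (2 * m) * spherical_profile m s 1
     else spherical_profile m s (length x - 1)
       + of_nat (2 * m - 1) * spherical_profile m s (length x + 1))"
    using x f by (rule sum_neighbours)
  have "(\<Sum>y\<in>neighbours (enat m) x. \<phi> y) = of_nat (2 * m) * (s * \<phi> x)"
  proof (cases "length x")
    case 0
    then show ?thesis unfolding sum f[OF x] by simp
  next
    case (Suc n)
    then have "x \<noteq> []" by auto
    then show ?thesis
      unfolding sum f[OF x] Suc using q(1)
      by (simp add: mult.assoc del: of_nat_mult of_nat_diff)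
  qed
  then show "(\<Sum>y\<in>neighbours (enat m) x. \<phi> y) / of_nat (card (neighbours (enat m) x)) = s * \<phi> x"
    unfolding card_neighbours[OF x] using q(2) by (simp del: of_nat_mult)
qed

lemma is_spherical_unique:
  assumes m: "1 \<le> m" and \<phi>: "is_spherical (enat m) s \<phi>"
    and x: "x \<in> carrier (free_group (enat m))"
  shows "\<phi> x = spherical_profile m s (length x)"
proof -
  define w :: "nat \<Rightarrow> word" where "w n = replicate n (0, True)" for n
  have w: "w n \<in> carrier (free_group (enat m))" "length (w n) = n" for n
  proof -
    have "reduced_word (w n)"
      unfolding w_def
    proof (induction n)
      case (Suc n) then show ?case by (cases n) auto
    qed simp
    then show "w n \<in> carrier (free_group (enat m))"
      using m by (auto simp: carrier_free_group w_def letters_enat)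
  qed (simp add: w_def)
  define f where "f n = \<phi> (w n)" for n
  have f: "\<phi> y = f (length y)" if "y \<in> carrier (free_group (enat m))" for y
    using \<phi> that w[of "length y"] unfolding f_def is_spherical_def radial_def by metis
  have q: "of_nat (2 * m - 1) \<noteq> (0 :: complex)" "of_nat (2 * m) \<noteq> (0 :: complex)"
    using m unfolding of_nat_eq_0_iff by auto
  have eig: "(\<Sum>y\<in>neighbours (enat m) (w n). \<phi> y) = of_nat (2 * m) * s * f n" for n
  proof -
    have "(\<Sum>y\<in>neighbours (enat m) (w n). \<phi> y) / of_nat (2 * m) = s * f n"
      using \<phi> w(1)[of n] card_neighbours[OF w(1)[of n]]
      unfolding is_spherical_def f_def by metis
    then show ?thesis
      using q(2) nonzero_divide_eq_eq[of "of_nat (2 * m)"] by (metis mult.assoc mult.commute)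
  qed
  have "f n = spherical_profile m s n" for n
  proof (induction n rule: spherical_profile.induct[of "\<lambda>_ _. (\<lambda>n. f n = spherical_profile m s n)" m s])
    case (1 m' s')
    then show ?case using \<phi> by (simp add: f_def w_def is_spherical_def one_free_group)
  next
    case (2 m' s')
    have "of_nat (2 * m) * f 1 = of_nat (2 * m) * (s * f 0)"
      using eig[of 0] sum_neighbours[where f = f, OF w(1) f, of 0] by (auto simp: w_def mult.assoc)
    then have "f 1 = s * f 0"
      using q(2) mult_left_cancel by blast
    moreover have "f 0 = 1" using \<phi> by (simp add: f_def w_def is_spherical_def one_free_group)
    ultimately show ?case by simp
  next
    case (3 m' s' n)
    have "w (Suc n) \<noteq> []" by (simp add: w_def)
    then have "f n + of_nat (2 * m - 1) * f (Suc (Suc n)) = of_nat (2 * m) * s * f (Suc n)"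
      using eig[of "Suc n"] sum_neighbours[where f = f, OF w(1) f, of "Suc n"]
      by (simp add: w(2) del: of_nat_mult of_nat_diff)
    then have "f (Suc (Suc n)) = (of_nat (2 * m) * s * f (Suc n) - f n) / of_nat (2 * m - 1)"
      using q(1) by (simp add: eq_divide_eq algebra_simps del: of_nat_mult of_nat_diff)
    then show ?case using 3 by (simp del: of_nat_mult of_nat_diff)
  qed
  then show ?thesis using f[OF x] by simp
qed

lemma is_spherical_spherical:
  assumes "1 \<le> m"
  shows "is_spherical (enat m) s (spherical (enat m) s)"
proof -
  let ?C = "carrier (free_group (enat m))"
  let ?P = "\<lambda>\<phi>. \<phi> \<in> extensional ?C \<and> is_spherical (enat m) s \<phi>"
  have "\<exists>!\<phi>. ?P \<phi>"
  proof (rule ex1I)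
    show "?P (restrict (\<lambda>x. spherical_profile m s (length x)) ?C)"
      using assms by (auto intro: is_spherical_cong)
    show "\<phi> = restrict (\<lambda>x. spherical_profile m s (length x)) ?C" if "?P \<phi>" for \<phi>
      using that is_spherical_unique[OF assms]
      by (intro extensionalityI[where A = ?C]) auto
  qed
  from theI'[OF this] show ?thesis by (simp add: spherical_def)
qed

lemma spherical_eq_profile:
  assumes "1 \<le> m" "x \<in> carrier (free_group (enat m))"
  shows "spherical (enat m) s x = spherical_profile m s (length x)"
  using is_spherical_unique[OF assms(1) is_spherical_spherical[OF assms(1)] assms(2)] .


section \<open>Representing measures\<close>

definition represents :: "enat \<Rightarrow> real measure \<Rightarrow> (word \<Rightarrow> complex) \<Rightarrow> bool" where
  "represents r \<mu> \<phi> \<longleftrightarrow>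
     finite_measure \<mu> \<and> sets \<mu> = sets (restrict_space borel {-1..1}) \<and>
     (\<forall>x\<in>carrier (free_group r). \<phi> x = (LINT s|\<mu>. spherical r (of_real s) x))"

end

(*
  For finite rank m put q = 2m - 1 and let T average a radial profile over neighbours. Averaging
  phi over the products y^-1 x of two walks of lengths k and l gives (T^(k+l) phi)(0), so positive
  definiteness makes a(n) = (T^n phi)(0) a bounded sequence with positive semidefinite Hankel
  matrices; such a sequence is the moment sequence of a measure on [-1,1] (Hausdorff), and the
  three-term recurrence turns "moments a(n)" into "integrals of the spherical functions phi(n)".
  Letting m tend to infinity, where T becomes the shift and the spherical profile becomes s^n, gives
  the Hankel condition for phi itself in infinite rank.

  Conversely phi_s is positive definite for |s| <= 1, because it is the Gram matrix of vectors
  built outwards along the tree: v(child) = ((q+1) s / q) v(x) - (1/q) v(parent) + sigma * noise, with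
  noise independent between different x and summing to zero over the children of x. Infinite rank is
  again a limit of finite ranks.
*)

theory Submission
  imports Defs "HOL-Probability.Helly_Selection" "HOL-Probability.Probability_Mass_Function"
    "HOL-Computational_Algebra.Polynomial" "HOL-Library.Sublist" "HOL-Real_Asymp.Real_Asymp"
begin

section \<open>Bounded Hankel-positive sequences\<close>

text \<open>Since phi_s is an eigenfunction of \<open>T\<close>, under the integral \<open>T\<close>
  acts as multiplication by s. So (T^k phi)(0) has to be the k-th moment of any representing
  measure; this produces the candidate measure and also its uniqueness, because a measure on a
  compact interval is determined by its moments. The interval [-1,1] enters at two places.
  Positivity of a functional on squares alone only gives a measure on the line; boundedness of the
  moments adds positivity on (1 - X^2) p^2. Conversely, the variance of the noise is (q+1)(1 -
  s^2)/q, which is nonnegative exactly for |s| \<le> 1. In infinite rank there is no average over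
  all neighbours. The averages are then taken over the first m generators only, inside the large
  group, and each Hankel inequality survives the limit because it is a closed condition on finitely
  many numbers.\<close>

text \<open>The Riesz functional of the sequence, sending X^n to \<open>a n\<close>.\<close>

definition moment_functional :: "(nat \<Rightarrow> real) \<Rightarrow> real poly \<Rightarrow> real" where
  "moment_functional a p = (\<Sum>i\<le>degree p. coeff p i * a i)"

lemma moment_functional_eq:
  assumes "degree p \<le> N"
  shows "moment_functional a p = (\<Sum>i\<le>N. coeff p i * a i)"
  unfolding moment_functional_def using assms
  by (intro sum.mono_neutral_left) (auto simp: coeff_eq_0)

lemma moment_functional_add:
  "moment_functional a (p + q) = moment_functional a p + moment_functional a q"
  using degree_add_le_max[of p q]
  by (simp add: moment_functional_eq[of _ "max (degree p) (degree q)"] algebra_simps sum.distrib)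

lemma moment_functional_smult: "moment_functional a (smult c p) = c * moment_functional a p"
  by (simp add: moment_functional_eq[of _ "degree p"] sum_distrib_left mult.assoc)

lemma moment_functional_diff:
  "moment_functional a (p - q) = moment_functional a p - moment_functional a q"
  using moment_functional_add[of a p "smult (-1) q"] moment_functional_smult[of a "-1" q] by simp

lemma moment_functional_0 [simp]: "moment_functional a 0 = 0"
  by (simp add: moment_functional_def)

lemma moment_functional_sum:
  "moment_functional a (\<Sum>i\<in>S. f i) = (\<Sum>i\<in>S. moment_functional a (f i))"
  by (induction S rule: infinite_finite_induct) (auto simp: moment_functional_add)

lemma moment_functional_monom: "moment_functional a (monom c n) = c * a n"
proof -
  have "moment_functional a (monom c n) = (\<Sum>i\<le>n. if i = n then c * a n else 0)"
    by (subst moment_functional_eq[OF degree_monom_le]) (intro sum.cong, auto)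
  then show ?thesis by simp
qed

lemma moment_functional_mult:
  "moment_functional a (p * q) = (\<Sum>i\<le>degree p. \<Sum>j\<le>degree q. coeff p i * coeff q j * a (i + j))"
proof -
  have "p * q = (\<Sum>i\<le>degree p. monom (coeff p i) i) * (\<Sum>j\<le>degree q. monom (coeff q j) j)"
    by (simp only: poly_as_sum_of_monoms)
  also have "\<dots> = (\<Sum>i\<le>degree p. \<Sum>j\<le>degree q. monom (coeff p i * coeff q j) (i + j))"
    by (simp add: sum_product mult_monom)
  finally show ?thesis
    by (simp add: moment_functional_sum moment_functional_monom)
qed

text \<open>Convexity makes the increments nondecreasing, so a positive first increment would force
  at least linear growth.\<close>

lemma convex_bounded_imp_decreasing:
  fixes c :: "nat \<Rightarrow> real"
  assumes convex: "\<And>k. 2 * c (Suc k) \<le> c k + c (Suc (Suc k))" and bdd: "\<And>k. c k \<le> B"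
  shows "c 1 \<le> c 0"
proof (rule ccontr)
  assume "\<not> c 1 \<le> c 0"
  then have d: "0 < c 1 - c 0" by simp
  have step: "c 1 - c 0 \<le> c (Suc k) - c k" for k
    proof (induction k)
    case (Suc k)
    then show ?case using convex[of k] by linarith
  qed simp
  have lin: "c 0 + real k * (c 1 - c 0) \<le> c k" for k
  proof (induction k)
    case (Suc k)
    then show ?case using step[of k] by (simp add: algebra_simps)
  qed simp
  obtain k where "B - c 0 < real k * (c 1 - c 0)"
    using reals_Archimedean3[OF d] by blast
  then show False using lin[of k] bdd[of k] by simp
qed

locale bounded_hankel =
  fixes a :: "nat \<Rightarrow> real"
  assumes psd: "0 \<le> (\<Sum>i\<le>N. \<Sum>j\<le>N. d i * d j * a (i + j))"
    and bounded: "\<bar>a n\<bar> \<le> a 0"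
begin

abbreviation "L \<equiv> moment_functional a"

lemma L_square_nonneg: "0 \<le> L (p * p)"
  unfolding moment_functional_mult by (rule psd)

text \<open>The bound does not depend on \<open>n\<close>; this uniformity is what the boundedness
  of the convex sequence below requires.\<close>

lemma L_monom_mult_le: "L (monom 1 n * p) \<le> (\<Sum>i\<le>degree p. \<bar>coeff p i\<bar>) * a 0"
proof -
  have "monom 1 n * p = monom 1 n * (\<Sum>i\<le>degree p. monom (coeff p i) i)"
    by (simp only: poly_as_sum_of_monoms)
  also have "\<dots> = (\<Sum>i\<le>degree p. monom (coeff p i) (n + i))"
    by (simp add: sum_distrib_left mult_monom)
  finally have "L (monom 1 n * p) = (\<Sum>i\<le>degree p. coeff p i * a (n + i))"
    by (simp add: moment_functional_sum moment_functional_monom)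
  also have "\<dots> \<le> (\<Sum>i\<le>degree p. \<bar>coeff p i\<bar> * a 0)"
  proof (rule sum_mono)
    fix i
    show "coeff p i * a (n + i) \<le> \<bar>coeff p i\<bar> * a 0"
      using mult_left_mono[OF bounded[of "n + i"] abs_ge_zero[of "coeff p i"]]
        abs_ge_self[of "coeff p i * a (n + i)"] by (simp add: abs_mult)
  qed
  finally show ?thesis by (simp add: sum_distrib_right)
qed

text \<open>The sequence \<open>k \<mapsto> L (X ^ (2 * k) * p\<^sup>2)\<close> is convex, since its second differences are
  values of \<open>L\<close> at squares, and bounded, hence decreasing.\<close>

lemma L_interval_nonneg: "0 \<le> L ((1 - monom 1 2) * (p * p))"
proof -
  define c where "c k = L (monom 1 (2 * k) * (p * p))" for k
  have "c 1 \<le> c 0"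
  proof (rule convex_bounded_imp_decreasing)
    show "c k \<le> (\<Sum>i\<le>degree (p * p). \<bar>coeff (p * p) i\<bar>) * a 0" for k
      unfolding c_def by (rule L_monom_mult_le)
    fix k
    define r where "r = monom 1 k * (p * (1 - monom 1 2))"
    have "monom 1 (2 * k) = monom 1 k * (monom 1 k :: real poly)"
        "monom 1 (2 * Suc k) = monom 1 2 * (monom 1 k * (monom 1 k :: real poly))"
        "monom 1 (2 * Suc (Suc k)) = monom 1 2 * (monom 1 2 * (monom 1 k * (monom 1 k :: real poly)))"
      by (simp_all add: mult_monom mult_2)
    moreover have "(Y * (p * (1 - X))) * (Y * (p * (1 - X)))
        = (Y * Y) * (p * p) - 2 * ((X * (Y * Y)) * (p * p)) + (X * (X * (Y * Y))) * (p * p)" for X Y :: "real poly"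
      by algebra
    ultimately have "r * r = monom 1 (2 * k) * (p * p) - 2 * (monom 1 (2 * Suc k) * (p * p))
        + monom 1 (2 * Suc (Suc k)) * (p * p)"
      unfolding r_def by (simp only:)
    then have "0 \<le> c k - 2 * c (Suc k) + c (Suc (Suc k))"
      unfolding c_def using L_square_nonneg[of r]
      by (simp only: mult_2 moment_functional_add moment_functional_diff)
    then show "2 * c (Suc k) \<le> c k + c (Suc (Suc k))" by simp
  qed
  moreover have "(1 - monom 1 2) * (p * p) = monom 1 (2 * 0) * (p * p) - monom 1 (2 * 1) * (p * p)"
    by (simp add: left_diff_distrib)
  ultimately show ?thesis
    by (simp only: c_def moment_functional_diff)
qed

end

section \<open>Bernstein weights and the moment problem on a bounded interval\<close>

text \<open>Factorial moments of the binomial distribution: C(j,k) C(n,j) = C(n,k) C(n-k,j-k)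
  reduces the sum to the binomial theorem for exponent n - k. A general ring is taken because
  \<open>t\<close> and \<open>u\<close> will be polynomials with sum 1.\<close>

lemma sum_binomial_weighted:
  fixes t u :: "'a :: comm_ring_1"
  assumes "t + u = 1" "k \<le> n"
  shows "(\<Sum>j\<le>n. of_nat (j choose k) * (of_nat (n choose j) * (t ^ j * u ^ (n - j)))) = of_nat (n choose k) * t ^ k"
proof -
  have "(\<Sum>j\<le>n. of_nat (j choose k) * (of_nat (n choose j) * (t ^ j * u ^ (n - j))))
      = (\<Sum>j\<in>{k..n}. of_nat (j choose k) * (of_nat (n choose j) * (t ^ j * u ^ (n - j))))"
    by (rule sum.mono_neutral_right) (auto simp: binomial_eq_0 not_le)
  also have "\<dots> = (\<Sum>i\<le>n - k. of_nat (n choose k) * t ^ k * (of_nat (n - k choose i) * t ^ i * u ^ (n - k - i)))"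
  proof (rule sum.reindex_bij_witness[of _ "\<lambda>i. i + k" "\<lambda>j. j - k"], goal_cases)
    case (5 j)
    then have kj: "k \<le> j" "j \<le> n" by auto
    have "of_nat (j choose k) * of_nat (n choose j) = (of_nat (n choose k) * of_nat (n - k choose (j - k)) :: 'a)"
      using choose_mult[OF kj] by (metis mult.commute of_nat_mult)
    then have "of_nat (j choose k) * (of_nat (n choose j) * (t ^ j * u ^ (n - j)))
        = of_nat (n choose k) * of_nat (n - k choose (j - k)) * (t ^ j * u ^ (n - j))"
      by (simp only: mult.assoc[symmetric])
    moreover have "t ^ j = t ^ k * t ^ (j - k)" "n - k - (j - k) = n - j"
      using kj by (auto simp flip: power_add)
    ultimately show ?case by (simp only: ac_simps)
  qed (use assms in auto)
  also have "\<dots> = of_nat (n choose k) * t ^ k * (t + u) ^ (n - k)"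
    by (simp add: binomial_ring sum_distrib_left)
  finally show ?thesis using assms by simp
qed

text \<open>Both terms are products of \<open>k\<close> factors of modulus at most 1, so their
  difference is bounded by the sum of the differences of the factors. The hypothesis
  \<open>2 * k < n\<close> bounds the factors (j - i)/(n - i) that are negative, namely when j <
  i.\<close>

lemma binomial_quotient_approx:
  assumes "j \<le> n" "2 * k < n"
  shows "\<bar>real (j choose k) / real (n choose k) - (real j / real n) ^ k\<bar> \<le> real k * real k / real (n - k)"
proof -
  have prod: "real (N choose k) = (\<Prod>i<k. real N - real i) / fact k" for N
    by (simp add: binomial_gbinomial gbinomial_prod_rev atLeast0LessThan)
  have "real (j choose k) / real (n choose k) = (\<Prod>i<k. (real j - real i) / (real n - real i))"
    by (simp add: prod prod_dividef)
  moreover have "(real j / real n) ^ k = (\<Prod>i<k. real j / real n)" by simp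
  moreover have "norm ((\<Prod>i<k. (real j - real i) / (real n - real i)) - (\<Prod>i<k. real j / real n))
      \<le> (\<Sum>i<k. norm ((real j - real i) / (real n - real i) - real j / real n))"
    by (rule norm_prod_diff) (use assms in \<open>auto simp: divide_simps abs_if\<close>)
  moreover have "\<dots> \<le> (\<Sum>i<k. real k / real (n - k))"
  proof (rule sum_mono)
    fix i assume "i \<in> {..<k}"
    then have i: "i < k" by simp
    have pos: "0 < real n - real i" "0 < real n" "real n - real k > 0" using i assms by auto
    have "(real j - real i) / (real n - real i) - real j / real n
        = - (real i * (real n - real j) / (real n * (real n - real i)))"
      using pos by (simp add: field_simps)
    then have "norm ((real j - real i) / (real n - real i) - real j / real n)
        = real i * (real n - real j) / (real n * (real n - real i))"
      using pos assms by simp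
    also have "\<dots> \<le> real k * real n / (real n * (real n - real k))"
      using pos assms i by (intro frac_le mult_mono) auto
    also have "\<dots> = real k / real (n - k)"
      using pos assms by (simp add: of_nat_diff)
    finally show "norm ((real j - real i) / (real n - real i) - real j / real n) \<le> real k / real (n - k)" .
  qed
  ultimately show ?thesis by simp
qed

context bounded_hankel
begin

text \<open>The substitution \<open>t = (1 + s) / 2\<close> carries \<open>[-1, 1]\<close> to \<open>[0, 1]\<close>; the two linear polynomials
  are \<open>t\<close> and \<open>1 - t\<close>. Nonnegativity is only available for even \<open>n\<close>, where the exponents of \<open>t\<close> and
  \<open>1 - t\<close> have equal parity.\<close>

definition bernstein_weight :: "nat \<Rightarrow> nat \<Rightarrow> real" where
  "bernstein_weight n j = L (of_nat (n choose j) * ([:1/2, 1/2:] ^ j * [:1/2, -1/2:] ^ (n - j)))"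

lemma L_of_nat_mult: "L (of_nat c * p) = real c * L p"
  by (simp add: of_nat_poly moment_functional_smult)

lemma bernstein_weight_nonneg:
  assumes "even n"
  shows "0 \<le> bernstein_weight n j"
proof (cases "j \<le> n")
  case True
  define t u :: "real poly" where "t = [:1/2, 1/2:]" and "u = [:1/2, -1/2:]"
  \<comment> \<open>This puts products with two odd exponents, a square times \<open>t * u\<close>,
    within reach of \<open>L_interval_nonneg\<close>.\<close>
  have tu: "t * u = smult (1/4) (1 - monom 1 2)"
    by (simp add: t_def u_def monom_altdef numeral_2_eq_2 one_pCons)
  have "0 \<le> L (t ^ j * u ^ (n - j))"
  proof (cases "even j")
    case True
    then obtain k l where "j = k + k" "n - j = l + l"
      using assms by (metis dvd_diff_nat evenE mult_2)
    then have "t ^ j * u ^ (n - j) = (t ^ k * u ^ l) * (t ^ k * u ^ l)"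
      by (simp add: power_add)
    then show ?thesis by (simp only: L_square_nonneg)
  next
    case False
    then have "odd (n - j)" using assms \<open>j \<le> n\<close> by (metis even_diff_nat even_add le_add_diff_inverse)
    then obtain k l where "j = Suc (k + k)" "n - j = Suc (l + l)"
      using False by (metis oddE mult_2 Suc_eq_plus1)
    then have "t ^ j * u ^ (n - j) = (t * u) * ((t ^ k * u ^ l) * (t ^ k * u ^ l))"
      by (simp add: power_add)
    also have "\<dots> = smult (1/4) ((1 - monom 1 2) * ((t ^ k * u ^ l) * (t ^ k * u ^ l)))"
      unfolding tu by (rule mult_smult_left)
    finally show ?thesis using L_interval_nonneg[of "t ^ k * u ^ l"] by (simp only: moment_functional_smult)
  qed
  then show ?thesis by (simp add: bernstein_weight_def L_of_nat_mult t_def u_def)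
qed (simp add: bernstein_weight_def binomial_eq_0)

lemma sum_bernstein_weight_binomial:
  assumes "k \<le> n"
  shows "(\<Sum>j\<le>n. real (j choose k) * bernstein_weight n j) = real (n choose k) * L ([:1/2, 1/2:] ^ k)"
proof -
  have "L (\<Sum>j\<le>n. of_nat (j choose k) * (of_nat (n choose j) * ([:1/2, 1/2:] ^ j * [:1/2, -1/2:] ^ (n - j))))
      = L (of_nat (n choose k) * [:1/2, 1/2:] ^ k)"
    using assms by (subst sum_binomial_weighted) (auto simp: one_pCons)
  then show ?thesis
    by (simp add: moment_functional_sum L_of_nat_mult bernstein_weight_def)
qed

lemma L_1 [simp]: "L 1 = a 0"
  using moment_functional_monom[of a 1 0] by (simp add: monom_0 one_pCons)

lemma sum_bernstein_weight: "(\<Sum>j\<le>n. bernstein_weight n j) = a 0"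
  using sum_bernstein_weight_binomial[of 0 n] by simp

text \<open>With binomial quotients in place of powers the sum equals the limit as soon as k \<le>
  N. Replacing the quotients by powers costs at most k^2/N times the total weight
  \<open>a 0\<close>; nonnegativity of the weights is what allows this estimate.\<close>

lemma bernstein_weight_moment_limit:
  "(\<lambda>N. \<Sum>j\<le>2 * N. (real j / real (2 * N)) ^ k * bernstein_weight (2 * N) j) \<longlonglongrightarrow> L ([:1/2, 1/2:] ^ k)"
proof (rule Lim_transform2)
  have "((\<lambda>N. \<Sum>j\<le>2 * N. (real (j choose k) / real (2 * N choose k)) * bernstein_weight (2 * N) j)
    \<longlonglongrightarrow> L ([:1/2, 1/2:] ^ k))"
  proof (rule tendsto_eventually, rule eventually_sequentiallyI)
    fix N assume "k \<le> N"
    then have "real (2 * N choose k) \<noteq> 0" by simp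
    then show "(\<Sum>j\<le>2 * N. (real (j choose k) / real (2 * N choose k)) * bernstein_weight (2 * N) j) = L ([:1/2, 1/2:] ^ k)"
      using sum_bernstein_weight_binomial[of k "2 * N"] \<open>k \<le> N\<close>
      by (simp add: sum_divide_distrib[symmetric])
  qed
  then show "(\<lambda>N. \<Sum>j\<le>2 * N. (real (j choose k) / real (2 * N choose k)) * bernstein_weight (2 * N) j)
    \<longlonglongrightarrow> L ([:1/2, 1/2:] ^ k)" .
  show "(\<lambda>N. (\<Sum>j\<le>2 * N. (real (j choose k) / real (2 * N choose k)) * bernstein_weight (2 * N) j)
      - (\<Sum>j\<le>2 * N. (real j / real (2 * N)) ^ k * bernstein_weight (2 * N) j)) \<longlonglongrightarrow> 0"
  proof (rule Lim_null_comparison)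
    show "\<forall>\<^sub>F N in sequentially. norm ((\<Sum>j\<le>2 * N. (real (j choose k) / real (2 * N choose k)) * bernstein_weight (2 * N) j)
      - (\<Sum>j\<le>2 * N. (real j / real (2 * N)) ^ k * bernstein_weight (2 * N) j))
      \<le> real k * real k / real N * a 0"
    proof (rule eventually_sequentiallyI)
      fix N assume N: "Suc k \<le> N"
      let ?w = "bernstein_weight (2 * N)"
      have "norm ((\<Sum>j\<le>2 * N. (real (j choose k) / real (2 * N choose k)) * ?w j)
          - (\<Sum>j\<le>2 * N. (real j / real (2 * N)) ^ k * ?w j))
        = norm (\<Sum>j\<le>2 * N. ((real (j choose k) / real (2 * N choose k)) - (real j / real (2 * N)) ^ k) * ?w j)"
        by (simp only: sum_subtractf left_diff_distrib)
      also have "\<dots> \<le> (\<Sum>j\<le>2 * N. real k * real k / real N * ?w j)"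
      proof (rule sum_norm_le)
        fix j assume "j \<in> {..2 * N}"
        then have "\<bar>real (j choose k) / real (2 * N choose k) - (real j / real (2 * N)) ^ k\<bar>
            \<le> real k * real k / real (2 * N - k)"
          using N by (intro binomial_quotient_approx) auto
        also have "\<dots> \<le> real k * real k / real N"
          using N by (intro divide_left_mono) auto
        finally show "norm ((real (j choose k) / real (2 * N choose k) - (real j / real (2 * N)) ^ k) * ?w j)
            \<le> real k * real k / real N * ?w j"
          using bernstein_weight_nonneg[of "2 * N" j, OF dvd_triv_left]
          by (simp only: real_norm_def abs_mult abs_of_nonneg mult_right_mono)
      qed
      also have "\<dots> = real k * real k / real N * a 0"
        by (subst sum_distrib_left[symmetric]) (simp only: sum_bernstein_weight)
      finally show "norm ((\<Sum>j\<le>2 * N. (real (j choose k) / real (2 * N choose k)) * ?w j)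
          - (\<Sum>j\<le>2 * N. (real j / real (2 * N)) ^ k * ?w j)) \<le> real k * real k / real N * a 0" .
    qed
    show "(\<lambda>N. real k * real k / real N * a 0) \<longlonglongrightarrow> 0"
      using tendsto_mult_left_zero[OF lim_const_over_n[of "real k * real k"]] by simp
  qed
qed

lemma ex_bernstein_distribution:
  assumes "0 < a 0"
  shows "\<exists>M. real_distribution M \<and> measure M {0..1} = 1 \<and>
    (\<forall>f :: real \<Rightarrow> real. f \<in> borel_measurable borel \<longrightarrow>
      a 0 * (LINT x|M. f x) = (\<Sum>j\<le>2 * N. f (real j / real (2 * N)) * bernstein_weight (2 * N) j))"
proof -
  define w where "w j = (if j \<le> 2 * N then bernstein_weight (2 * N) j / a 0 else 0)" for j
  have w: "0 \<le> w j" for j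
    using assms bernstein_weight_nonneg[of "2 * N" j] by (simp add: w_def)
  have "(\<integral>\<^sup>+ j. ennreal (w j) \<partial>count_space UNIV) = (\<Sum>j\<le>2 * N. ennreal (w j))"
    by (rule nn_integral_count_space'[where A = "{..2 * N}"]) (auto simp: w_def)
  also have "\<dots> = ennreal (\<Sum>j\<le>2 * N. w j)"
    using w by (intro sum_ennreal) auto
  also have "(\<Sum>j\<le>2 * N. w j) = 1"
    using assms sum_bernstein_weight[of "2 * N"] by (simp add: w_def flip: sum_divide_distrib)
  finally have 1: "(\<integral>\<^sup>+ j. ennreal (w j) \<partial>count_space UNIV) = 1" by simp
  define P where "P = embed_pmf w"
  have pmf: "pmf P j = w j" for j
    unfolding P_def using w 1 by (rule Probability_Mass_Function.pmf_embed_pmf)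
  \<comment> \<open>For \<open>N = 0\<close> the only point is 0/0 = 0, which still lies in the unit
    interval.\<close>
  define x where "x j = real j / real (2 * N)" for j
  define M where "M = distr (measure_pmf P) borel x"
  interpret M: real_distribution M
    unfolding M_def by (rule prob_space.real_distribution_distr) (simp_all add: measure_pmf.prob_space_axioms)
  have LINT: "a 0 * (LINT y|M. f y) = (\<Sum>j\<le>2 * N. f (x j) * bernstein_weight (2 * N) j)"
    if "f \<in> borel_measurable borel" for f :: "real \<Rightarrow> real"
  proof -
    have "(LINT y|M. f y) = (LINT j|measure_pmf P. f (x j))"
      unfolding M_def using that by (subst integral_distr) auto
    also have "\<dots> = (\<Sum>j\<le>2 * N. f (x j) * pmf P j)"
      by (rule integral_measure_pmf_real) (auto simp: set_pmf_eq pmf w_def split: if_splits)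
    finally show ?thesis
      using assms by (simp add: pmf w_def sum_distrib_left)
  qed
  have "measure M {0..1} = (LINT y|M. indicator {0..1} y)"
    by simp
  then have "a 0 * measure M {0..1} = (\<Sum>j\<le>2 * N. indicator {0..1} (x j) * bernstein_weight (2 * N) j)"
    using LINT[of "indicator {0..1}"] by simp
  also have "\<dots> = (\<Sum>j\<le>2 * N. bernstein_weight (2 * N) j)"
    by (intro sum.cong) (auto simp: x_def divide_simps split: split_indicator)
  finally have "measure M {0..1} = 1"
    using assms by (simp add: sum_bernstein_weight)
  with LINT M.real_distribution_axioms show ?thesis by (auto simp: x_def)
qed

text \<open>Helly selection applied to the Bernstein laws. Clamping turns the powers into bounded
  continuous functions on the whole line, so weak convergence applies to them directly and the
  support of the limit need not be located.\<close>

lemma ex_unit_interval_distribution: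
  assumes "0 < a 0"
  shows "\<exists>M. real_distribution M \<and> (\<forall>k. (LINT x|M. max 0 (min 1 x) ^ k) = L ([:1/2, 1/2:] ^ k) / a 0)"
proof -
  obtain \<mu> where \<mu>: "\<And>N. real_distribution (\<mu> N)" "\<And>N. measure (\<mu> N) {0..1} = 1"
      "\<And>N f. f \<in> borel_measurable borel \<Longrightarrow> a 0 * (LINT x|\<mu> N. f x) =
        (\<Sum>j\<le>2 * N. f (real j / real (2 * N)) * bernstein_weight (2 * N) j)"
    using ex_bernstein_distribution[OF assms] by metis
  have "tight \<mu>"
    unfolding tight_def
  proof (intro conjI allI impI \<mu>(1))
    fix \<epsilon> :: real assume "0 < \<epsilon>"
    \<comment> \<open>Tightness is phrased with half-open intervals; the left end lies below 0 so
      that an atom at 0 is included.\<close>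
    have "1 \<le> measure (\<mu> N) {-1<..1}" for N
    proof -
      interpret real_distribution "\<mu> N" by (rule \<mu>(1))
      have "measure (\<mu> N) {0..1} \<le> measure (\<mu> N) {-1<..1}"
        by (intro finite_measure_mono) auto
      then show ?thesis by (simp only: \<mu>(2))
    qed
    then show "\<exists>a b. a < b \<and> (\<forall>N. 1 - \<epsilon> < measure (\<mu> N) {a<..b})"
      using \<open>0 < \<epsilon>\<close> by (intro exI[of _ "-1"] exI[of _ 1]) (auto intro: less_le_trans[of _ 1])
  qed
  then obtain s M where s: "strict_mono s" and M: "real_distribution M" and conv: "weak_conv_m (\<mu> \<circ> s) M"
    using tight_imp_convergent_subsubsequence[of \<mu> id] by (auto simp: strict_mono_id)
  have "(LINT x|M. max 0 (min 1 x) ^ k) = L ([:1/2, 1/2:] ^ k) / a 0" for k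
  proof (rule LIMSEQ_unique)
    let ?f = "\<lambda>x::real. max 0 (min 1 x) ^ k"
    show "(\<lambda>N. LINT x|(\<mu> \<circ> s) N. ?f x) \<longlonglongrightarrow> (LINT x|M. ?f x)"
    proof (rule weak_conv_imp_integral_bdd_continuous_conv)
      show "isCont ?f x" for x by (intro continuous_intros)
      show "norm (?f x) \<le> 1" for x by (auto simp: norm_power intro!: power_le_one)
    qed (use \<mu>(1) M conv in \<open>auto simp: comp_def\<close>)
    have "(LINT x|\<mu> N. ?f x) = (\<Sum>j\<le>2 * N. (real j / real (2 * N)) ^ k * bernstein_weight (2 * N) j) / a 0" for N
    proof -
      have "a 0 * (LINT x|\<mu> N. ?f x) = (\<Sum>j\<le>2 * N. ?f (real j / real (2 * N)) * bernstein_weight (2 * N) j)"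
        by (rule \<mu>(3)) measurable
      also have "\<dots> = (\<Sum>j\<le>2 * N. (real j / real (2 * N)) ^ k * bernstein_weight (2 * N) j)"
        by (intro sum.cong arg_cong2[of _ _ _ _ "\<lambda>x y. x ^ k * y"]) (auto simp: divide_simps)
      finally show ?thesis using assms by (simp add: field_simps)
    qed
    moreover have "(\<lambda>N. (\<Sum>j\<le>2 * N. (real j / real (2 * N)) ^ k * bernstein_weight (2 * N) j) / a 0)
        \<longlonglongrightarrow> L ([:1/2, 1/2:] ^ k) / a 0"
      using assms by (intro tendsto_divide bernstein_weight_moment_limit) auto
    ultimately have "(\<lambda>N. LINT x|\<mu> N. ?f x) \<longlonglongrightarrow> L ([:1/2, 1/2:] ^ k) / a 0" by simp
    from LIMSEQ_subseq_LIMSEQ[OF this s]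
    show "(\<lambda>N. LINT x|(\<mu> \<circ> s) N. ?f x) \<longlonglongrightarrow> L ([:1/2, 1/2:] ^ k) / a 0"
      by (simp add: comp_def)
  qed
  with M show ?thesis by blast
qed

text \<open>The substitution is undone by pushing forward along the clamped map 2t - 1, which lands
  in [-1,1] wherever the limit law lives; the density \<open>a 0\<close> restores the total mass. If
  \<open>a 0\<close> is zero, the bound kills the whole sequence and the null measure works.\<close>

theorem ex_moment_measure:
  "\<exists>\<mu>. finite_measure \<mu> \<and> sets \<mu> = sets (restrict_space borel {-1..1}) \<and> (\<forall>n. (LINT s|\<mu>. s ^ n) = a n)"
proof (cases "a 0 = 0")
  case True
  then have "a n = 0" for n using bounded[of n] by simp
  then show ?thesis
    by (intro exI[of _ "null_measure (restrict_space borel {-1..1})"])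
      (auto intro!: finite_measureI simp: integral_null_measure)
next
  case False
  then have pos: "0 < a 0" using bounded[of 0] by simp
  obtain M where M: "real_distribution M"
      and mom: "\<And>k. (LINT x|M. max 0 (min 1 x) ^ k) = L ([:1/2, 1/2:] ^ k) / a 0"
    using ex_unit_interval_distribution[OF pos] by blast
  interpret M: real_distribution M by (rule M)
  define X :: "real \<Rightarrow> real" where "X x = 2 * max 0 (min 1 x) - 1" for x
  have X [measurable]: "X \<in> M \<rightarrow>\<^sub>M restrict_space borel {-1..1}"
    unfolding X_def by (intro measurable_restrict_space2) auto
  define \<nu> where "\<nu> = distr M (restrict_space borel {-1..1}) X"
  interpret \<nu>: prob_space \<nu>
    unfolding \<nu>_def by (rule M.prob_space_distr[OF X])
  define \<mu> where "\<mu> = density \<nu> (\<lambda>_. ennreal (a 0))"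
  have "(LINT s|\<mu>. s ^ n) = a n" for n
  proof -
    have meas: "(\<lambda>s::real. s ^ n) \<in> borel_measurable (restrict_space borel {-1..1})"
      by (intro measurable_restrict_space1) measurable
    have "(LINT s|\<mu>. s ^ n) = a 0 * (LINT s|\<nu>. s ^ n)"
      unfolding \<mu>_def using pos meas by (subst integral_real_density) (auto simp: \<nu>_def)
    also have "(LINT s|\<nu>. s ^ n) = (LINT x|M. X x ^ n)"
      unfolding \<nu>_def using meas by (subst integral_distr[OF X]) auto
    also have "\<dots> = (LINT x|M. (\<Sum>k\<le>n. real (n choose k) * 2 ^ k * (-1) ^ (n - k) * max 0 (min 1 x) ^ k))"
    proof (rule Bochner_Integration.integral_cong[OF refl])
      fix x :: real
      show "X x ^ n = (\<Sum>k\<le>n. real (n choose k) * 2 ^ k * (-1) ^ (n - k) * max 0 (min 1 x) ^ k)"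
        unfolding X_def diff_conv_add_uminus binomial_ring by (intro sum.cong) (auto simp: power_mult_distrib)
    qed
    also have "\<dots> = (\<Sum>k\<le>n. real (n choose k) * 2 ^ k * (-1) ^ (n - k) * (LINT x|M. max 0 (min 1 x) ^ k))"
    proof (subst Bochner_Integration.integral_sum)
      fix k
      have "integrable M (\<lambda>x. max 0 (min 1 x) ^ k :: real)"
        by (rule M.integrable_const_bound[of _ 1]) (auto simp: norm_power intro!: power_le_one)
      then show "integrable M (\<lambda>x. real (n choose k) * 2 ^ k * (-1) ^ (n - k) * max 0 (min 1 x) ^ k)"
        by (rule integrable_mult_right)
    qed simp
    also have "a 0 * \<dots> = (\<Sum>k\<le>n. real (n choose k) * 2 ^ k * (-1) ^ (n - k) * L ([:1/2, 1/2:] ^ k))"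
      using pos unfolding mom by (simp add: sum_distrib_left)
    also have "\<dots> = L (\<Sum>k\<le>n. smult (real (n choose k) * 2 ^ k * (-1) ^ (n - k)) ([:1/2, 1/2:] ^ k))"
      by (simp only: moment_functional_sum moment_functional_smult)
    \<comment> \<open>The binomial expansion of \<open>X x ^ n\<close> is now summed up again inside
      \<open>L\<close>, where 2t - 1 is the indeterminate itself.\<close>
    also have "\<And>t. (\<Sum>k\<le>n. smult (real (n choose k) * 2 ^ k * (-1) ^ (n - k)) (t ^ k)) = (smult 2 t + [:-1:]) ^ n"
      unfolding binomial_ring by (intro sum.cong) (auto simp: smult_power of_nat_poly mult_ac poly_const_pow)
    also have "smult 2 [:1/2, 1/2:] + [:-1:] = monom (1::real) 1"
      by (simp add: monom_altdef)
    also have "L (monom 1 1 ^ n) = a n"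
      by (simp add: monom_power moment_functional_monom)
    finally show ?thesis .
  qed
  moreover have "finite_measure \<mu>"
    unfolding \<mu>_def
    by (rule finite_measureI) (simp add: emeasure_density \<nu>.emeasure_space_1 nn_integral_cmult ennreal_mult_eq_top_iff)
  ultimately show ?thesis
    by (intro exI[of _ \<mu>]) (simp add: \<mu>_def \<nu>_def)
qed

end

section \<open>Uniqueness of moments\<close>

lemma integrable_continuous_on_interval:
  fixes f :: "real \<Rightarrow> 'a :: {banach, second_countable_topology}"
  assumes "finite_measure \<mu>" and sets: "sets \<mu> = sets (restrict_space borel {-1..1})"
    and cont: "continuous_on {-1..1} f"
  shows "integrable \<mu> f"
proof -
  interpret finite_measure \<mu> by fact
  have space: "space \<mu> = {-1..1}"
    using sets_eq_imp_space_eq[OF sets] by (simp add: space_restrict_space)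
  have "bounded (f ` {-1..1})"
    by (intro compact_imp_bounded compact_continuous_image cont) simp
  then obtain B where "\<And>x. x \<in> {-1..1} \<Longrightarrow> norm (f x) \<le> B"
    unfolding bounded_iff by blast
  moreover have "f \<in> borel_measurable \<mu>"
    unfolding measurable_cong_sets[OF sets refl]
    by (rule borel_measurable_continuous_on_restrict[OF cont])
  ultimately show ?thesis
    using space by (intro integrable_const_bound[of _ B]) (auto intro!: AE_I2)
qed

text \<open>Weierstrass approximation: integrals of polynomials agree, and a uniform error is
  multiplied only by the finite total masses.\<close>

lemma integral_eq_of_moments_eq:
  fixes f :: "real \<Rightarrow> real"
  assumes \<mu>: "finite_measure \<mu>" "sets \<mu> = sets (restrict_space borel {-1..1})"
    and \<nu>: "finite_measure \<nu>" "sets \<nu> = sets (restrict_space borel {-1..1})"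
    and mom: "\<And>n. (LINT s|\<mu>. s ^ n) = (LINT s|\<nu>. s ^ n)"
    and f: "continuous_on {-1..1} f"
  shows "(LINT s|\<mu>. f s) = (LINT s|\<nu>. f s)"
proof -
  have close: "\<bar>(LINT s|\<kappa>. f s) - (LINT s|\<kappa>. g s)\<bar> \<le> e * measure \<kappa> (space \<kappa>)"
    if \<kappa>: "finite_measure \<kappa>" "sets \<kappa> = sets (restrict_space borel {-1..1})"
      and g: "continuous_on {-1..1} g" "\<And>x. x \<in> {-1..1} \<Longrightarrow> \<bar>f x - g x\<bar> < e" for \<kappa> g e
  proof -
    interpret finite_measure \<kappa> by fact
    have space: "space \<kappa> = {-1..1}"
      using sets_eq_imp_space_eq[OF \<kappa>(2)] by (simp add: space_restrict_space)
    note int = integrable_continuous_on_interval[OF \<kappa>]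
    have "\<bar>(LINT s|\<kappa>. f s) - (LINT s|\<kappa>. g s)\<bar> = norm (LINT s|\<kappa>. f s - g s)"
      using int[OF f] int[OF g(1)] by simp
    also have "\<dots> \<le> (LINT s|\<kappa>. norm (f s - g s))"
      by (rule integral_norm_bound)
    also have "\<dots> \<le> (LINT s|\<kappa>. e)"
      using int[OF f] int[OF g(1)] g(2) space by (intro integral_mono) (auto simp: less_imp_le)
    finally show ?thesis by (simp add: mult.commute)
  qed
  let ?C = "measure \<mu> (space \<mu>) + measure \<nu> (space \<nu>)"
  have bound: "\<bar>(LINT s|\<mu>. f s) - (LINT s|\<nu>. f s)\<bar> \<le> e * ?C" if "e > 0" for e
  proof -
    obtain g where g: "real_polynomial_function g" "\<And>x. x \<in> {-1..1} \<Longrightarrow> \<bar>f x - g x\<bar> < e"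
      using Stone_Weierstrass_real_polynomial_function[OF _ f \<open>e > 0\<close>] by auto
    then obtain c n where c: "g = (\<lambda>x. \<Sum>i\<le>n. c i * x ^ i)"
      unfolding real_polynomial_function_iff_sum by blast
    have cont: "continuous_on {-1..1} g" unfolding c by (intro continuous_intros)
    have "(LINT s|\<kappa>. g s) = (\<Sum>i\<le>n. c i * (LINT s|\<kappa>. s ^ i))"
      if \<kappa>: "finite_measure \<kappa>" "sets \<kappa> = sets (restrict_space borel {-1..1})" for \<kappa>
      unfolding c
      by (subst Bochner_Integration.integral_sum)
        (auto intro!: integrable_continuous_on_interval[OF \<kappa>] continuous_intros)
    then have "(LINT s|\<mu>. g s) = (LINT s|\<nu>. g s)" using \<mu> \<nu> mom by simp
    then show ?thesis
      using close[OF \<mu> cont g(2)] close[OF \<nu> cont g(2)] by (simp add: distrib_left)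
  qed
  have C: "0 \<le> ?C" by simp
  have "\<bar>(LINT s|\<mu>. f s) - (LINT s|\<nu>. f s)\<bar> \<le> 0 + e" if "e > 0" for e
  proof -
    \<comment> \<open>The summand 1 keeps the denominator positive when both measures
      vanish.\<close>
    have "\<bar>(LINT s|\<mu>. f s) - (LINT s|\<nu>. f s)\<bar> \<le> e / (?C + 1) * ?C"
      using that C by (intro bound) (simp add: add_nonneg_pos)
    also have "\<dots> \<le> e"
      using that C by (simp add: divide_simps add_nonneg_pos)
    finally show ?thesis by simp
  qed
  from field_le_epsilon[OF this] show ?thesis by simp
qed

lemma norm_cts_step_le: "a < b \<Longrightarrow> \<bar>cts_step a b x\<bar> \<le> 1"
  by (auto simp: cts_step_def)

text \<open>Continuous ramps that fall from 1 to 0 just to the right of \<open>x\<close> converge to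
  the indicator of \<open>{..x}\<close>, so equal integrals of continuous functions give equal
  distribution functions.\<close>

lemma measure_eqI_moments:
  assumes \<mu>: "finite_measure \<mu>" "sets \<mu> = sets (restrict_space borel {-1..1::real})"
    and \<nu>: "finite_measure \<nu>" "sets \<nu> = sets (restrict_space borel {-1..1})"
    and mom: "\<And>n. (LINT s|\<mu>. s ^ n) = (LINT s|\<nu>. s ^ n)"
  shows "\<mu> = \<nu>"
proof -
  have lim: "(\<lambda>n. LINT s|\<kappa>. cts_step x (x + 1 / real (Suc n)) s) \<longlonglongrightarrow> measure \<kappa> ({..x} \<inter> {-1..1})"
    if \<kappa>: "finite_measure \<kappa>" "sets \<kappa> = sets (restrict_space borel {-1..1::real})" for \<kappa> x
  proof -
    interpret finite_measure \<kappa> by fact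
    have space: "space \<kappa> = {-1..1}"
      using sets_eq_imp_space_eq[OF \<kappa>(2)] by (simp add: space_restrict_space)
    have "(\<lambda>n. LINT s|\<kappa>. cts_step x (x + 1 / real (Suc n)) s) \<longlonglongrightarrow> (LINT s|\<kappa>. indicator {..x} s)"
    proof (rule integral_dominated_convergence[where w = "\<lambda>_. 1"])
      show "AE s in \<kappa>. (\<lambda>n. cts_step x (x + 1 / real (Suc n)) s) \<longlonglongrightarrow> indicator {..x} s"
      proof (rule AE_I2)
        fix s
        show "(\<lambda>n. cts_step x (x + 1 / real (Suc n)) s) \<longlonglongrightarrow> indicator {..x} s"
        proof (cases "s \<le> x")
          case False
          then have "eventually (\<lambda>n. 1 / real (Suc n) < s - x) sequentially"
            using order_tendstoD(2)[OF LIMSEQ_Suc[OF lim_1_over_n], of "s - x"] by simp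
          then show ?thesis
            using False by (intro tendsto_eventually) (auto elim!: eventually_mono simp: cts_step_def)
        qed (simp add: cts_step_def)
      qed
      show "AE s in \<kappa>. norm (cts_step x (x + 1 / real (Suc n)) s) \<le> 1" for n
        by (rule AE_I2) (simp add: norm_cts_step_le)
      have "cts_step x (x + 1 / real (Suc n)) \<in> borel_measurable borel" for n
        by (intro borel_measurable_continuous_onI uniformly_continuous_imp_continuous
            cts_step_uniformly_continuous) simp
      then show "cts_step x (x + 1 / real (Suc n)) \<in> borel_measurable \<kappa>" for n
        unfolding measurable_cong_sets[OF \<kappa>(2) refl] by (rule measurable_restrict_space1)
      show "indicator {..x} \<in> borel_measurable \<kappa>"
        unfolding measurable_cong_sets[OF \<kappa>(2) refl] by (rule measurable_restrict_space1) simp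
    qed simp
    moreover have "(LINT s|\<kappa>. indicator {..x} s) = measure \<kappa> ({..x} \<inter> {-1..1})"
      by (simp add: space)
    ultimately show ?thesis by (simp only:)
  qed
  have eq: "measure \<mu> ({..x} \<inter> {-1..1}) = measure \<nu> ({..x} \<inter> {-1..1})" for x
  proof -
    have "(LINT s|\<mu>. cts_step x (x + 1 / real (Suc n)) s) = (LINT s|\<nu>. cts_step x (x + 1 / real (Suc n)) s)" for n
    proof (rule integral_eq_of_moments_eq[OF \<mu> \<nu> mom])
      have "continuous_on UNIV (cts_step x (x + 1 / real (Suc n)))"
        by (intro uniformly_continuous_imp_continuous cts_step_uniformly_continuous) simp
      then show "continuous_on {-1..1} (cts_step x (x + 1 / real (Suc n)))"
        by (rule continuous_on_subset) simp
    qed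
    then have "(\<lambda>n. LINT s|\<mu>. cts_step x (x + 1 / real (Suc n)) s) \<longlonglongrightarrow> measure \<nu> ({..x} \<inter> {-1..1})"
      using lim[OF \<nu>, of x] by (simp only:)
    with lim[OF \<mu>, of x] show ?thesis by (rule LIMSEQ_unique)
  qed
  \<comment> \<open>Distribution functions belong to measures on the line, so both measures are
    pushed forward along the inclusion of [-1,1]; this changes the measure of no subset of the
    interval.\<close>
  have borel: "finite_borel_measure (distr \<kappa> borel (\<lambda>s. s))"
      "cdf (distr \<kappa> borel (\<lambda>s. s)) x = measure \<kappa> ({..x} \<inter> {-1..1})"
      "A \<in> sets \<kappa> \<Longrightarrow> emeasure (distr \<kappa> borel (\<lambda>s. s)) A = emeasure \<kappa> A"
    if \<kappa>: "finite_measure \<kappa>" "sets \<kappa> = sets (restrict_space borel {-1..1::real})" for \<kappa> x A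
  proof -
    have space: "space \<kappa> = {-1..1}"
      using sets_eq_imp_space_eq[OF \<kappa>(2)] by (simp add: space_restrict_space)
    have id [measurable]: "(\<lambda>s. s) \<in> \<kappa> \<rightarrow>\<^sub>M borel"
      unfolding measurable_cong_sets[OF \<kappa>(2) refl] by (intro measurable_restrict_space1) measurable
    show "finite_borel_measure (distr \<kappa> borel (\<lambda>s. s))"
      using finite_measure.finite_measure_distr[OF \<kappa>(1) id]
      by (simp add: finite_borel_measure_def finite_borel_measure_axioms_def)
    show "cdf (distr \<kappa> borel (\<lambda>s. s)) x = measure \<kappa> ({..x} \<inter> {-1..1})"
      by (simp add: cdf_def measure_distr space)
    show "emeasure (distr \<kappa> borel (\<lambda>s. s)) A = emeasure \<kappa> A" if "A \<in> sets \<kappa>"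
      using that by (auto simp: emeasure_distr space \<kappa>(2) sets_restrict_space Int_absorb2 intro!: arg_cong[where f = "emeasure \<kappa>"])
  qed
  have distr: "distr \<mu> borel (\<lambda>s. s) = distr \<nu> borel (\<lambda>s. s)"
    using borel(1,2)[OF \<mu>] borel(1,2)[OF \<nu>] eq by (intro cdf_unique') (auto simp: fun_eq_iff)
  show ?thesis
  proof (rule measure_eqI)
    fix A assume "A \<in> sets \<mu>"
    then show "emeasure \<mu> A = emeasure \<nu> A"
      using borel(3)[OF \<mu>, of A] borel(3)[OF \<nu>, of A] distr \<mu>(2) \<nu>(2) by simp
  qed (simp add: \<mu>(2) \<nu>(2))
qed

section \<open>Positive definiteness of spherical functions\<close>

fun real_profile :: "nat \<Rightarrow> real \<Rightarrow> nat \<Rightarrow> real" where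
  "real_profile m s 0 = 1"
| "real_profile m s (Suc 0) = s"
| "real_profile m s (Suc (Suc n)) =
     (real (2 * m) * s * real_profile m s (Suc n) - real_profile m s n) / real (2 * m - 1)"

lemma spherical_profile_of_real:
  "spherical_profile m (of_real s) n = of_real (real_profile m s n)"
  by (induction m s n rule: real_profile.induct) (simp_all del: of_nat_diff)

section \<open>The tree of words and the Gram vectors on it\<close>

text \<open>An edge appends one letter at the end of a list. On reduced words this is the metric of
  the Cayley graph, by \<open>length_inverse_mult\<close>.\<close>

fun tree_dist :: "'a list \<Rightarrow> 'a list \<Rightarrow> nat" where
  "tree_dist (a # x) (b # y) = (if a = b then tree_dist x y else length x + length y + 2)"
| "tree_dist x y = length x + length y"

lemma tree_dist_commute: "tree_dist x y = tree_dist y x"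
  by (induction x y rule: tree_dist.induct) auto

lemma tree_dist_same [simp]: "tree_dist x x = 0"
  by (induction x) auto

lemma tree_dist_Nil [simp]: "tree_dist [] y = length y" "tree_dist x [] = length x"
  by (cases y; simp) (cases x; simp)

text \<open>Crossing an edge of a tree changes the distance to \<open>x\<close> by exactly one;
  whether \<open>x\<close> lies beyond the edge decides the sign, here and in the next
  lemma.\<close>

lemma tree_dist_snoc_prefix: "prefix (y @ [b]) x \<Longrightarrow> tree_dist x y = Suc (tree_dist x (y @ [b]))"
proof (induction y arbitrary: x)
  case (Cons c y)
  then show ?case by (cases x) auto
qed (auto simp: prefix_def)

lemma tree_dist_snoc_not_prefix: "\<not> prefix (y @ [b]) x \<Longrightarrow> tree_dist x (y @ [b]) = Suc (tree_dist x y)"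
proof (induction y arbitrary: x)
  case Nil
  then show ?case by (cases x) auto
next
  case (Cons c y)
  then show ?case by (cases x) auto
qed

lemma inv_free_group:
  assumes "x \<in> carrier (free_group r)"
  shows "inv\<^bsub>free_group r\<^esub> x = map inv_letter (rev x)"
proof -
  interpret group "free_group r" by (rule group_free_group)
  have "map inv_letter (rev x) \<in> carrier (free_group r)"
    using assms reduced_inverse[of x] by (auto simp: carrier_free_group)
  moreover have "map inv_letter (rev x) \<otimes>\<^bsub>free_group r\<^esub> x = \<one>\<^bsub>free_group r\<^esub>"
    by (simp add: mult_free_group one_free_group foldr_cancel_left_inv)
  ultimately show ?thesis using assms by (intro inv_equality)
qed

text \<open>Cancellation in the product consumes exactly the common prefix: once the first letters
  differ, the inverted word followed by the other word is already reduced.\<close>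

lemma length_inverse_mult_list:
  assumes "reduced_word x" "reduced_word y"
  shows "length (foldr cancel_cons (map inv_letter (rev x)) y) = tree_dist x y"
  using assms
proof (induction x y rule: tree_dist.induct)
  case (1 a x b y)
  show ?case
  proof (cases "a = b")
    case True
    then show ?thesis using 1 by (auto dest: reduced_tl)
  next
    case False
    have "reduced_word (map inv_letter (rev (a # x)) @ (b # y))"
      unfolding reduced_append_iff using False 1 reduced_inverse[of "a # x"] by simp
    from foldr_cancel_reduced[OF this] False show ?thesis by (simp del: foldr_append foldr.simps)
  qed
next
  case ("2_1" y)
  then show ?case by simp
next
  case ("2_2" x)
  then have "reduced_word (map inv_letter (rev x) @ [])"
    using reduced_inverse by simp
  from foldr_cancel_reduced[OF this] show ?case by simp
qed

lemma length_inverse_mult: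
  assumes "x \<in> carrier (free_group r)" "y \<in> carrier (free_group r)"
  shows "length (inv\<^bsub>free_group r\<^esub> x \<otimes>\<^bsub>free_group r\<^esub> y) = tree_dist x y"
  using assms length_inverse_mult_list[of x y]
  by (simp add: inv_free_group mult_free_group carrier_free_group)

text \<open>Eliminates the group operation: only a kernel depending on the tree distance
  remains.\<close>

lemma positive_definite_radial_iff:
  assumes "\<forall>x\<in>carrier (free_group r). \<phi> x = f (length x)"
  shows "positive_definite (free_group r) \<phi> \<longleftrightarrow>
    (\<forall>(n::nat) x c. (\<forall>j<n. x j \<in> carrier (free_group r)) \<longrightarrow>
      (\<Sum>j<n. \<Sum>k<n. c j * cnj (c k) * f (tree_dist (x k) (x j))) \<in> \<real>\<^sub>\<ge>\<^sub>0)"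
proof -
  interpret group "free_group r" by (rule group_free_group)
  have "(\<Sum>j<n. \<Sum>k<n. c j * cnj (c k) * \<phi> (inv\<^bsub>free_group r\<^esub> (x k) \<otimes>\<^bsub>free_group r\<^esub> x j))
      = (\<Sum>j<n. \<Sum>k<n. c j * cnj (c k) * f (tree_dist (x k) (x j)))"
    if "\<forall>j<n. x j \<in> carrier (free_group r)" for n :: nat and x c
    using that by (intro sum.cong refl) (simp add: assms length_inverse_mult)
  then show ?thesis
    unfolding positive_definite_def by (intro iff_allI imp_cong) auto
qed

text \<open>Words grow at the head here, so the parent of \<open>a # y\<close> is \<open>y\<close> and these are the words of the
  Cayley graph read backwards; this is why distances below are taken between reversed words.\<close>

definition children :: "nat \<Rightarrow> word \<Rightarrow> word set" where
  "children m y = {a # y | a. a \<in> letters (enat m) \<and> reduced_word (a # y)}"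

text \<open>For a child \<open>a # y\<close>, this is its unit vector projected onto the functions
  on the children of \<open>y\<close> with sum zero. It has squared norm 1 - 1/c, and two siblings
  have inner product -1/c, where c is the number of children.\<close>

definition innovation :: "nat \<Rightarrow> letter \<Rightarrow> word \<Rightarrow> word \<Rightarrow> real" where
  "innovation m a y z = of_bool (z = a # y) - of_bool (z \<in> children m y) / real (card (children m y))"

text \<open>The scale for which every \<open>tree_vector\<close> has norm 1.\<close>

definition innovation_scale :: "nat \<Rightarrow> real \<Rightarrow> real" where
  "innovation_scale m s = sqrt (real (2 * m) * (1 - s\<^sup>2) / real (2 * m - 1))"

text \<open>The coefficients are those of the recurrence for \<open>real_profile\<close>. The root
  has no parent and one child more, hence its own clause; the same scale serves there, since s^2 +
  sigma^2 (1 - 1/(2m)) = 1.\<close>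

fun tree_vector :: "nat \<Rightarrow> real \<Rightarrow> word \<Rightarrow> word \<Rightarrow> real" where
  "tree_vector m s [] z = of_bool (z = [])"
| "tree_vector m s [a] z = s * tree_vector m s [] z
     + innovation_scale m s * innovation m a [] z"
| "tree_vector m s (a # b # x) z =
     real (2 * m) * s / real (2 * m - 1) * tree_vector m s (b # x) z - 1 / real (2 * m - 1) * tree_vector m s x z
     + innovation_scale m s * innovation m a (b # x) z"

lemma Cons_in_children:
  "a # x \<in> children m y \<longleftrightarrow> x = y \<and> a \<in> letters (enat m) \<and> reduced_word (a # x)"
  by (auto simp: children_def simp del: split_paired_Ex)

lemma finite_children: "finite (children m y)"
  unfolding children_def
  by (rule finite_subset[of _ "(\<lambda>a. a # y) ` letters (enat m)"]) (auto simp: finite_letters)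

lemma length_children: "z \<in> children m y \<Longrightarrow> length z = Suc (length y)"
  by (auto simp: children_def)

lemma card_children:
  assumes "y \<in> carrier (free_group (enat m))"
  shows "card (children m y) = (if y = [] then 2 * m else 2 * m - 1)"
proof (cases y)
  case Nil
  then have "children m y = (\<lambda>a. [a]) ` letters (enat m)" by (auto simp: children_def)
  then show ?thesis using Nil by (simp add: card_image card_letters inj_on_def)
next
  case (Cons b w)
  with assms have b: "inv_letter b \<in> letters (enat m)" by (simp add: carrier_free_group)
  have "children m y = (\<lambda>a. a # y) ` (letters (enat m) - {inv_letter b})"
    using assms Cons by (auto simp: children_def carrier_free_group inv_letter_swap)
  then show ?thesis
    using Cons b by (simp add: card_image card_letters finite_letters inj_on_def)
qed

lemma sum_innovation_children:
  assumes "a # y \<in> children m y"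
  shows "(\<Sum>z\<in>children m y. innovation m a y z) = 0"
proof -
  have "card (children m y) \<noteq> 0" using assms finite_children[of m y] by auto
  moreover have "(\<Sum>z\<in>children m y. of_bool (z = a # y)) = (1::real)"
    using assms finite_children[of m y] by (simp add: of_bool_def)
  ultimately show ?thesis
    by (simp add: innovation_def sum_subtractf)
qed

text \<open>The vector of \<open>x\<close> occupies no coordinate longer than \<open>x\<close>,
  which makes it orthogonal to all innovations introduced at deeper levels.\<close>

lemma tree_vector_longer: "length x < length z \<Longrightarrow> tree_vector m s x z = 0"
proof (induction m s x z rule: tree_vector.induct)
qed (auto simp: innovation_def dest: length_children)

lemma tree_vector_same_length:
  assumes "length z = Suc (length y)"
  shows "tree_vector m s (a # y) z = innovation_scale m s * innovation m a y z"
  using assms by (cases y) (auto simp: tree_vector_longer)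

text \<open>A common finite set of coordinates. Unreduced words are harmless here, as the vectors of
  reduced words vanish on them.\<close>

definition ball_words :: "nat \<Rightarrow> nat \<Rightarrow> word set" where
  "ball_words m n = {z. set z \<subseteq> letters (enat m) \<and> length z \<le> n}"

lemma finite_ball_words: "finite (ball_words m n)"
  unfolding ball_words_def by (intro finite_lists_length_le finite_letters)

lemma sum_mult_innovation:
  assumes "a # y \<in> children m y" "set y \<subseteq> letters (enat m)" "Suc (length y) \<le> n"
  shows "(\<Sum>z\<in>ball_words m n. f z * innovation m a y z)
    = f (a # y) - (\<Sum>z\<in>children m y. f z) / card (children m y)"
proof -
  have sub: "children m y \<subseteq> ball_words m n"
    using assms by (auto simp: children_def ball_words_def)
  have "(\<Sum>z\<in>ball_words m n. f z * of_bool (z = a # y)) = f (a # y)"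
    using sub assms(1) finite_ball_words[of m n] by (simp add: of_bool_def if_distrib cong: if_cong) auto
  moreover have "(\<Sum>z\<in>ball_words m n. f z * of_bool (z \<in> children m y)) = (\<Sum>z\<in>children m y. f z)"
    using sub finite_ball_words[of m n]
    by (simp add: of_bool_def if_distrib sum.inter_restrict[symmetric] Int_absorb1 cong: if_cong)
  ultimately show ?thesis
    by (simp add: innovation_def right_diff_distrib sum_subtractf flip: sum_divide_distrib)
qed

text \<open>A new innovation is seen only by words with the same parent: shorter vectors vanish on
  the children of \<open>y\<close>, and vectors of equal length with another parent carry their
  innovation on a disjoint set of children.\<close>

lemma tree_vector_innovation:
  assumes ay: "a # y \<in> children m y" and y: "set y \<subseteq> letters (enat m)" "Suc (length y) \<le> n"
    and x: "length x \<le> Suc (length y)" "x \<in> carrier (free_group (enat m))"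
  shows "(\<Sum>z\<in>ball_words m n. tree_vector m s x z * innovation m a y z) =
    (if x \<noteq> [] \<and> tl x = y
     then innovation_scale m s * (of_bool (x = a # y) - 1 / card (children m y))
     else 0)"
proof (cases "length x = Suc (length y)")
  case False
  then have "tree_vector m s x z = 0" if "length z = Suc (length y)" for z
    using x that by (intro tree_vector_longer) simp
  moreover have neg: "\<not> (x \<noteq> [] \<and> tl x = y)" using False by (cases x) auto
  ultimately show ?thesis
    unfolding sum_mult_innovation[OF ay y] if_not_P[OF neg] by (simp add: length_children)
next
  case True
  then obtain b w where bw: "x = b # w" "length w = length y" by (cases x) auto
  let ?\<sigma> = "innovation_scale m s"
  have vec: "tree_vector m s x z = ?\<sigma> * innovation m b w z" if "length z = Suc (length y)" for z
    using that bw by (simp add: tree_vector_same_length)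
  have sum: "(\<Sum>z\<in>ball_words m n. tree_vector m s x z * innovation m a y z)
      = ?\<sigma> * (innovation m b w (a # y) - (\<Sum>z\<in>children m y. innovation m b w z) / card (children m y))"
    unfolding sum_mult_innovation[OF ay y]
    by (simp add: vec length_children right_diff_distrib sum_distrib_left)
  show ?thesis
  proof (cases "w = y")
    case True
    then have "b # y \<in> children m y"
      using x(2) bw by (auto simp: Cons_in_children carrier_free_group)
    then show ?thesis
      unfolding sum using True bw ay sum_innovation_children[of b y m]
      by (auto simp: innovation_def)
  next
    case False
    have "innovation m b w z = 0" if "z \<in> children m y" for z
      using that False by (auto simp: children_def innovation_def)
    then show ?thesis unfolding sum using False bw ay by simp
  qed
qed

text \<open>The inner products of a vector with itself and with a sibling; ((q+1) s^2 - 1)/q is the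
  value of the profile at distance 2.\<close>

lemma innovation_scale_identities:
  fixes q s :: real
  assumes "q \<noteq> 0"
  shows "(q + 1) * s / q * s - 1 / q * (((q + 1) * s * s - 1) / q)
      + (q + 1) * (1 - s\<^sup>2) / q * (1 - 1 / q) = 1"
    and "(q + 1) * s / q * s - 1 / q * (((q + 1) * s * s - 1) / q)
      + (q + 1) * (1 - s\<^sup>2) / q * (0 - 1 / q) = ((q + 1) * s * s - 1) / q"
  using assms by (simp_all add: field_simps power2_eq_square)

text \<open>The longer of the two vectors is expanded by its recursion, and the innovation term is
  orthogonal to the other vector unless both words have the same parent. Reversal reconciles growth
  at the head with a distance that compares prefixes.\<close>

lemma tree_vector_gram:
  assumes m: "1 \<le> m" and s: "\<bar>s\<bar> \<le> 1"
    and "x \<in> carrier (free_group (enat m))" "y \<in> carrier (free_group (enat m))"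
    and "length x \<le> n" "length y \<le> n"
  shows "(\<Sum>z\<in>ball_words m n. tree_vector m s x z * tree_vector m s y z)
    = real_profile m s (tree_dist (rev x) (rev y))"
  using assms(3-)
proof (induction "length x + length y" arbitrary: x y rule: less_induct)
  case less
  define ip where "ip u v = (\<Sum>z\<in>ball_words m n. u z * v z)" for u v :: "word \<Rightarrow> real"
  define \<sigma> where "\<sigma> = innovation_scale m s"
  have "s\<^sup>2 \<le> 1" using s by (simp add: abs_square_le_1)
  then have \<sigma>: "\<sigma> * \<sigma> = real (2 * m) * (1 - s\<^sup>2) / real (2 * m - 1)"
    using m by (simp add: \<sigma>_def innovation_scale_def)
  have IH: "ip (tree_vector m s u) (tree_vector m s v) = real_profile m s (tree_dist (rev u) (rev v))"
    if "length u + length v < length x + length y" "u \<in> carrier (free_group (enat m))"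
      "v \<in> carrier (free_group (enat m))" "length u \<le> n" "length v \<le> n" for u v
    unfolding ip_def by (rule less(1)) (use that in auto)
  \<comment> \<open>By symmetry of inner product and distance, only pairs whose second word is at
    least as long need an expansion.\<close>
  have goal: "ip (tree_vector m s u) (tree_vector m s v) = real_profile m s (tree_dist (rev u) (rev v))"
    if uv: "length u + length v = length x + length y" "length u \<le> length v"
      "u \<in> carrier (free_group (enat m))" "v \<in> carrier (free_group (enat m))" "length u \<le> n" "length v \<le> n" for u v
  proof -
    have q: "real (2 * m - 1) = 2 * real m - 1" "2 * real m - 1 > 0" using m by auto
    consider "v = []" | a where "v = [a]" | a b w where "v = a # b # w"
      by (metis neq_Nil_conv)
    then show ?thesis
    proof cases
      case 1
      then have "u = []" using uv by simp
      moreover have "ip (tree_vector m s []) (tree_vector m s []) = 1"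
        using finite_ball_words[of m n] by (simp add: ip_def ball_words_def of_bool_def if_distrib cong: if_cong)
      ultimately show ?thesis using 1 by simp
    next
      case 2
      have ch: "[a] \<in> children m []" using uv 2 by (simp add: Cons_in_children carrier_free_group)
      have card: "card (children m []) = 2 * m" by (simp add: card_children carrier_free_group)
      have "ip (tree_vector m s u) (tree_vector m s v)
          = s * ip (tree_vector m s u) (tree_vector m s []) + \<sigma> * ip (tree_vector m s u) (innovation m a [])"
        unfolding 2 ip_def \<sigma>_def
        by (simp add: sum_distrib_left sum.distrib algebra_simps)
      also have "ip (tree_vector m s u) (tree_vector m s []) = real_profile m s (length u)"
        using uv 2 by (subst IH) (auto simp: carrier_free_group)
      also have "ip (tree_vector m s u) (innovation m a []) = 
          (if u = [] then 0 else \<sigma> * (of_bool (u = [a]) - 1 / (2 * m)))"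
      proof -
        have "tl u = []" if "u \<noteq> []" using that uv 2 by (cases u) auto
        then show ?thesis
          unfolding ip_def \<sigma>_def using uv 2 card by (subst tree_vector_innovation[OF ch]) auto
      qed
      finally have eq: "ip (tree_vector m s u) (tree_vector m s v) = s * real_profile m s (length u)
          + (if u = [] then 0 else \<sigma> * \<sigma> * (of_bool (u = [a]) - 1 / (2 * m)))"
        by simp
      consider "u = []" | b where "u = [b]" using uv 2 by (auto simp: length_Suc_conv le_Suc_eq)
      then show ?thesis
      proof cases
        case 1
        then show ?thesis using eq 2 by simp
      next
        case b: 2
        show ?thesis
          unfolding eq using b 2 q m
          by (simp add: \<sigma> numeral_2_eq_2) (simp add: field_simps power2_eq_square)
      qed
    next
      case 3
      have w: "b # w \<in> carrier (free_group (enat m))" "w \<in> carrier (free_group (enat m))"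
        using uv 3 by (auto simp: carrier_free_group dest: reduced_tl)
      have ch: "a # b # w \<in> children m (b # w)" using uv 3 by (auto simp: Cons_in_children carrier_free_group)
      have card: "card (children m (b # w)) = 2 * m - 1" using w(1) by (simp add: card_children)
      have "ip (tree_vector m s u) (tree_vector m s v)
          = real (2 * m) * s / real (2 * m - 1) * ip (tree_vector m s u) (tree_vector m s (b # w))
          - 1 / real (2 * m - 1) * ip (tree_vector m s u) (tree_vector m s w)
          + \<sigma> * ip (tree_vector m s u) (innovation m a (b # w))"
        unfolding 3 ip_def \<sigma>_def sum_distrib_left sum.distrib[symmetric] sum_subtractf[symmetric]
        by (intro sum.cong refl) (simp add: algebra_simps)
      also have "ip (tree_vector m s u) (tree_vector m s (b # w)) = real_profile m s (tree_dist (rev u) (rev w @ [b]))"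
        using uv 3 w by (subst IH) auto
      also have "ip (tree_vector m s u) (tree_vector m s w) = real_profile m s (tree_dist (rev u) (rev w))"
        using uv 3 w by (subst IH) auto
      also have "ip (tree_vector m s u) (innovation m a (b # w)) =
          (if u \<noteq> [] \<and> tl u = b # w then \<sigma> * (of_bool (u = v) - 1 / real (2 * m - 1)) else 0)"
        unfolding ip_def \<sigma>_def using uv 3 w ch card q
        by (subst tree_vector_innovation) (auto simp: carrier_free_group)
      finally have eq: "ip (tree_vector m s u) (tree_vector m s v)
        = real (2 * m) * s / real (2 * m - 1) * real_profile m s (tree_dist (rev u) (rev w @ [b]))
          - 1 / real (2 * m - 1) * real_profile m s (tree_dist (rev u) (rev w))
          + (if u \<noteq> [] \<and> tl u = b # w then \<sigma> * \<sigma> * (of_bool (u = v) - 1 / real (2 * m - 1)) else 0)"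
        by simp
      show ?thesis
      proof (cases "suffix (b # w) u")
        \<comment> \<open>Here \<open>u\<close> lies outside the subtree below the parent of
          \<open>v\<close>, so the distances to \<open>w\<close>, to \<open>b # w\<close> and to
          \<open>v\<close> grow by one each time, and the recurrence is all that is left.\<close>
        case False
        then have npre: "\<not> prefix (rev w @ [b]) (rev u)" "\<not> prefix ((rev w @ [b]) @ [a]) (rev u)"
          using append_prefixD[of "rev w @ [b]" "[a]" "rev u"] by (auto simp: suffix_to_prefix)
        have neg: "\<not> (u \<noteq> [] \<and> tl u = b # w)" using False by (auto simp: neq_Nil_conv suffix_Cons)
        then show ?thesis
          unfolding eq if_not_P[OF neg] unfolding 3 rev.simps using npre[THEN tree_dist_snoc_not_prefix] q
          by (simp add: diff_divide_distrib)
      next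
        case True
        then obtain t where t: "u = t @ b # w" by (auto simp: suffix_def)
        \<comment> \<open>As \<open>u\<close> is not longer than \<open>v\<close>, it is either the
          parent of \<open>v\<close> or a child of that parent.\<close>
        have "length t \<le> 1" using uv 3 t by simp
        then consider "t = []" | c where "t = [c]" by (cases t) auto
        then show ?thesis
        proof cases
          case 1
          have "tree_dist (rev w @ [b]) (rev w) = 1" "tree_dist (rev w @ [b]) ((rev w @ [b]) @ [a]) = 1"
            using tree_dist_snoc_prefix[of "rev w" b "rev w @ [b]"]
              tree_dist_snoc_not_prefix[of "rev w @ [b]" a "rev w @ [b]"]
            by (auto dest: prefix_length_le)
          moreover have "real (2 * m) * s / real (2 * m - 1) - s / real (2 * m - 1) = s"
            using q by (simp add: divide_eq_eq algebra_simps flip: diff_divide_distrib)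
          ultimately show ?thesis
            unfolding eq unfolding 3 t 1 by simp
        next
          case 2
          have d: "tree_dist ((rev w @ [b]) @ [c]) (rev w @ [b]) = 1" "tree_dist ((rev w @ [b]) @ [c]) (rev w) = 2"
            using tree_dist_snoc_prefix[of "rev w" b "(rev w @ [b]) @ [c]"]
              tree_dist_snoc_prefix[of "rev w @ [b]" c "(rev w @ [b]) @ [c]"] by auto
          have "tree_dist ((rev w @ [b]) @ [c]) ((rev w @ [b]) @ [a]) = (if a = c then 0 else 2)"
            using tree_dist_snoc_not_prefix[of "rev w @ [b]" a "(rev w @ [b]) @ [c]"] d by auto
          moreover have "real (2 * m) = real (2 * m - 1) + 1" using m by simp
          ultimately show ?thesis
            unfolding eq unfolding 3 t 2 using d q innovation_scale_identities[of "real (2 * m - 1)" s]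
            by (cases "a = c") (simp_all add: \<sigma> numeral_2_eq_2 del: of_nat_mult of_nat_diff)
        qed
      qed
    qed
  qed
  have "ip (tree_vector m s x) (tree_vector m s y) = real_profile m s (tree_dist (rev x) (rev y))"
  proof (cases "length x \<le> length y")
    case True
    then show ?thesis using less by (intro goal) auto
  next
    case False
    then have "ip (tree_vector m s y) (tree_vector m s x) = real_profile m s (tree_dist (rev y) (rev x))"
      using less by (intro goal) auto
    then show ?thesis by (simp add: ip_def mult.commute tree_dist_commute)
  qed
  then show ?case by (simp add: ip_def)
qed

lemma carrier_rev:
  "x \<in> carrier (free_group r) \<Longrightarrow> rev x \<in> carrier (free_group r)"
proof -
  assume "x \<in> carrier (free_group r)"
  then have "set x \<subseteq> letters r" "successively (\<lambda>a b. a \<noteq> inv_letter b) x"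
    unfolding carrier_free_group reduced_word_def
    by (auto elim!: successively_mono simp: inv_letter_swap)
  then show ?thesis by (simp add: carrier_free_group reduced_word_def)
qed

lemma real_profile_kernel:
  fixes N :: nat
  assumes m: "1 \<le> m" and s: "\<bar>s\<bar> \<le> 1" and x: "\<And>j. j < N \<Longrightarrow> x j \<in> carrier (free_group (enat m))"
  shows "(\<Sum>j<N. \<Sum>k<N. c j * cnj (c k) * of_real (real_profile m s (tree_dist (x k) (x j)))) \<in> \<real>\<^sub>\<ge>\<^sub>0"
proof -
  \<comment> \<open>One radius for all the words, so that every Gram entry is a sum over the same
    coordinates; inserting 0 covers the case of no words.\<close>
  define n where "n = Max (insert 0 ((\<lambda>j. length (x j)) ` {..<N}))"
  have n: "length (x j) \<le> n" if "j < N" for j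
    unfolding n_def using that by (intro Max_ge) auto
  define v where "v j z = (of_real (tree_vector m s (rev (x j)) z) :: complex)" for j z
  have gram: "of_real (real_profile m s (tree_dist (x k) (x j))) = (\<Sum>z\<in>ball_words m n. v j z * v k z)"
    if "j < N" "k < N" for j k
    using tree_vector_gram[OF m s carrier_rev[OF x] carrier_rev[OF x], of k j n] that n
    by (simp add: v_def mult.commute flip: of_real_mult of_real_sum)
  have "(\<Sum>j<N. \<Sum>k<N. c j * cnj (c k) * of_real (real_profile m s (tree_dist (x k) (x j))))
      = (\<Sum>j<N. \<Sum>k<N. \<Sum>z\<in>ball_words m n. (c j * v j z) * cnj (c k * v k z))"
    by (intro sum.cong refl) (simp add: gram sum_distrib_left v_def mult_ac)
  also have "\<dots> = (\<Sum>j<N. \<Sum>z\<in>ball_words m n. \<Sum>k<N. (c j * v j z) * cnj (c k * v k z))"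
    by (intro sum.cong refl sum.swap)
  also have "\<dots> = (\<Sum>z\<in>ball_words m n. \<Sum>j<N. \<Sum>k<N. (c j * v j z) * cnj (c k * v k z))"
    by (rule sum.swap)
  also have "\<dots> = (\<Sum>z\<in>ball_words m n. (\<Sum>j<N. c j * v j z) * cnj (\<Sum>j<N. c j * v j z))"
    by (simp only: sum_product cnj_sum)
  also have "\<dots> = of_real (\<Sum>z\<in>ball_words m n. (cmod (\<Sum>j<N. c j * v j z))\<^sup>2)"
    by (simp only: of_real_sum complex_norm_square)
  finally show ?thesis
    by (simp only: nonneg_Reals_of_real_iff) (intro sum_nonneg zero_le_power2)
qed

section \<open>Spherical kernels in infinite rank as limits of finite rank\<close>

lemma real_profile_tendsto: "(\<lambda>m. real_profile m s n) \<longlonglongrightarrow> s ^ n"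
proof (induction n rule: induct_nat_012)
  case (ge2 n)
  have "(\<lambda>m. (real (2 * m) / real (2 * m - 1)) * (s * real_profile m s (Suc n))
      - 1 / real (2 * m - 1) * real_profile m s n) \<longlonglongrightarrow> 1 * (s * s ^ Suc n) - 0 * s ^ n"
    by (intro tendsto_intros ge2) real_asymp+
  then show ?case by (simp add: diff_divide_distrib mult.assoc)
qed auto

text \<open>Finitely many words involve finitely many generators, so each single test of positive
  definiteness already happens in all sufficiently large finite ranks.\<close>

lemma finite_subset_letters:
  assumes "finite A" "A \<subseteq> letters r"
  shows "\<exists>M. \<forall>m\<ge>M. A \<subseteq> letters (enat m)"
proof -
  have "A \<subseteq> letters (enat m)" if "Suc (Max (insert 0 (fst ` A))) \<le> m" for m
  proof
    fix a assume "a \<in> A"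
    then have "fst a \<le> Max (insert 0 (fst ` A))" using assms(1) by (intro Max_ge) auto
    then show "a \<in> letters (enat m)" using that by (cases a) (auto simp: letters_enat)
  qed
  then show ?thesis by blast
qed

definition real_spherical :: "enat \<Rightarrow> real \<Rightarrow> nat \<Rightarrow> real" where
  "real_spherical r s n = (case r of enat m \<Rightarrow> real_profile m s n | \<infinity> \<Rightarrow> s ^ n)"

lemma spherical_of_real:
  assumes "1 \<le> r" "x \<in> carrier (free_group r)"
  shows "spherical r (of_real s) x = of_real (real_spherical r s (length x))"
proof (cases r)
  case (enat m)
  with assms show ?thesis
    by (simp add: real_spherical_def spherical_eq_profile one_enat_def spherical_profile_of_real)
qed (simp add: real_spherical_def spherical_def)

lemma real_spherical_kernel:
  fixes N :: nat
  assumes r: "1 \<le> r" and s: "\<bar>s\<bar> \<le> 1" and x: "\<And>j. j < N \<Longrightarrow> x j \<in> carrier (free_group r)"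
  shows "(\<Sum>j<N. \<Sum>k<N. c j * cnj (c k) * of_real (real_spherical r s (tree_dist (x k) (x j)))) \<in> \<real>\<^sub>\<ge>\<^sub>0"
proof (cases r)
  case (enat m)
  then show ?thesis
    using real_profile_kernel[of m s N x c] r s x by (simp add: real_spherical_def one_enat_def)
next
  case infinity
  let ?A = "\<Union>j<N. set (x j)"
  have "?A \<subseteq> letters r" using x by (auto simp: carrier_free_group)
  then obtain M where M: "\<And>m. m \<ge> M \<Longrightarrow> ?A \<subseteq> letters (enat m)"
    using finite_subset_letters[of ?A r] by auto
  \<comment> \<open>The shift by \<open>Suc M\<close> makes every rank in the sequence positive and
    large enough to contain all the words.\<close>
  let ?S = "\<lambda>m. \<Sum>j<N. \<Sum>k<N. c j * cnj (c k) * of_real (real_profile (m + Suc M) s (tree_dist (x k) (x j)))"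
  show ?thesis
  proof (rule closed_sequentially[OF closed_nonneg_Reals_complex])
    fix m
    have "x j \<in> carrier (free_group (enat (m + Suc M)))" if "j < N" for j
      using M[of "m + Suc M"] x[OF that] that by (auto simp: carrier_free_group)
    then show "?S m \<in> \<real>\<^sub>\<ge>\<^sub>0" using s by (intro real_profile_kernel) auto
  next
    show "?S \<longlonglongrightarrow> (\<Sum>j<N. \<Sum>k<N. c j * cnj (c k) * of_real (real_spherical r s (tree_dist (x k) (x j))))"
      unfolding real_spherical_def infinity enat.case
      by (intro tendsto_intros LIMSEQ_ignore_initial_segment real_profile_tendsto)
  qed
qed

section \<open>Averages along walks\<close>

definition neighbour_average :: "nat \<Rightarrow> (nat \<Rightarrow> real) \<Rightarrow> nat \<Rightarrow> real" where
  "neighbour_average m f n =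
     (if n = 0 then f 1 else (f (n - 1) + real (2 * m - 1) * f (n + 1)) / real (2 * m))"

lemma sum_letters_neighbour_average:
  assumes m: "1 \<le> m" and g: "g \<in> carrier (free_group (enat m))"
  shows "(\<Sum>a\<in>letters (enat m). f (length (foldr cancel_cons g [a])))
    = real (2 * m) * neighbour_average m f (length g)"
proof -
  have "(\<Sum>a\<in>letters (enat m). complex_of_real (f (length (foldr cancel_cons g [a]))))
      = (\<Sum>y\<in>neighbours (enat m) g. of_real (f (length y)))"
    unfolding neighbours_def mult_free_group using inj_on_mult_letter[of g] g
    by (subst sum.reindex) (auto intro: inj_on_subset simp: carrier_free_group)
  also have "\<dots> = of_real (real (2 * m) * neighbour_average m f (length g))"
    using m by (subst sum_neighbours[OF g, where f = "\<lambda>n. of_real (f n)"])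
      (auto simp: neighbour_average_def simp del: of_nat_mult of_nat_diff)
  finally show ?thesis by (simp only: of_real_eq_iff flip: of_real_sum)
qed

text \<open>Walks need not be reduced: an element is counted once for each walk that ends there, as
  iterated averages demand.\<close>

definition walks :: "nat \<Rightarrow> nat \<Rightarrow> word set" where
  "walks m l = {x. set x \<subseteq> letters (enat m) \<and> length x = l}"

lemma finite_walks: "finite (walks m l)"
  unfolding walks_def by (intro finite_lists_length_eq finite_letters)

definition endpoint :: "word \<Rightarrow> word" where
  "endpoint x = foldr cancel_cons x []"

lemma endpoint_carrier: "set x \<subseteq> letters r \<Longrightarrow> endpoint x \<in> carrier (free_group r)"
  using set_foldr_cancel[of x "[]"] reduced_foldr[of "[]" x] by (auto simp: endpoint_def carrier_free_group)

text \<open>The first step of the walk is split off and absorbed into the starting point, so one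
  average over letters is gained per step.\<close>

lemma sum_walks:
  assumes m: "1 \<le> m" and g: "g \<in> carrier (free_group (enat m))"
  shows "(\<Sum>x\<in>walks m l. f (length (g \<otimes>\<^bsub>free_group (enat m)\<^esub> endpoint x)))
    = real (2 * m) ^ l * (neighbour_average m ^^ l) f (length g)"
  using g
proof (induction l arbitrary: g)
  case 0
  have "walks m 0 = {[]}" by (auto simp: walks_def)
  moreover have "foldr cancel_cons g [] = g"
    using foldr_cancel_reduced[of g "[]"] 0 by (simp add: carrier_free_group)
  ultimately show ?case by (simp add: mult_free_group endpoint_def)
next
  case (Suc l)
  interpret group "free_group (enat m)" by (rule group_free_group)
  have step: "g \<otimes>\<^bsub>free_group (enat m)\<^esub> endpoint (a # x)
      = foldr cancel_cons g [a] \<otimes>\<^bsub>free_group (enat m)\<^esub> endpoint x" for a x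
    using foldr_cancel_assoc[of "endpoint x" g "[a]"] reduced_foldr[of "[]" x]
    by (simp add: mult_free_group endpoint_def)
  have carr: "foldr cancel_cons g [a] \<in> carrier (free_group (enat m))" if "a \<in> letters (enat m)" for a
    using m_closed[OF Suc.prems, of "[a]"] that by (simp add: mult_free_group carrier_free_group)
  have "walks m (Suc l) = (\<lambda>(a, x). a # x) ` (letters (enat m) \<times> walks m l)"
    by (auto simp: walks_def length_Suc_conv image_iff)
  then have "(\<Sum>x\<in>walks m (Suc l). f (length (g \<otimes>\<^bsub>free_group (enat m)\<^esub> endpoint x)))
      = (\<Sum>(a, x)\<in>letters (enat m) \<times> walks m l. f (length (g \<otimes>\<^bsub>free_group (enat m)\<^esub> endpoint (a # x))))"
    by (simp add: sum.reindex inj_on_def case_prod_beta')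
  also have "\<dots> = (\<Sum>a\<in>letters (enat m). \<Sum>x\<in>walks m l.
      f (length (foldr cancel_cons g [a] \<otimes>\<^bsub>free_group (enat m)\<^esub> endpoint x)))"
    by (simp add: sum.cartesian_product step)
  also have "\<dots> = (\<Sum>a\<in>letters (enat m). real (2 * m) ^ l *
      (neighbour_average m ^^ l) f (length (foldr cancel_cons g [a])))"
    by (intro sum.cong refl Suc.IH carr)
  also have "\<dots> = real (2 * m) ^ Suc l * (neighbour_average m ^^ Suc l) f (length g)"
    using sum_letters_neighbour_average[OF m Suc.prems] by (simp flip: sum_distrib_left)
  finally show ?case .
qed

text \<open>The inner sum depends only on the length of the inverse of \<open>endpoint y\<close>,
  which is the length of \<open>endpoint y\<close> itself. The outer sum is therefore again a walk
  from the identity, and the exponents add.\<close>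

lemma sum_walks_pairs:
  assumes m: "1 \<le> m"
  shows "(\<Sum>y\<in>walks m k. \<Sum>x\<in>walks m l.
      f (length (inv\<^bsub>free_group (enat m)\<^esub> endpoint y \<otimes>\<^bsub>free_group (enat m)\<^esub> endpoint x)))
    = real (2 * m) ^ (k + l) * (neighbour_average m ^^ (k + l)) f 0"
proof -
  interpret group "free_group (enat m)" by (rule group_free_group)
  have carr: "endpoint y \<in> carrier (free_group (enat m))" if "y \<in> walks m k" for y
    using that by (intro endpoint_carrier) (simp add: walks_def)
  have "(\<Sum>y\<in>walks m k. \<Sum>x\<in>walks m l.
      f (length (inv\<^bsub>free_group (enat m)\<^esub> endpoint y \<otimes>\<^bsub>free_group (enat m)\<^esub> endpoint x)))
    = (\<Sum>y\<in>walks m k. real (2 * m) ^ l * (neighbour_average m ^^ l) f (length (endpoint y)))"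
    proof (intro sum.cong refl)
    fix y assume y: "y \<in> walks m k"
    then have "length (inv\<^bsub>free_group (enat m)\<^esub> endpoint y) = length (endpoint y)"
      by (simp add: inv_free_group carr)
    then show "(\<Sum>x\<in>walks m l. f (length (inv\<^bsub>free_group (enat m)\<^esub> endpoint y \<otimes>\<^bsub>free_group (enat m)\<^esub> endpoint x)))
        = real (2 * m) ^ l * (neighbour_average m ^^ l) f (length (endpoint y))"
      using y by (simp only: sum_walks[OF m inv_closed] carr)
  qed
  also have "\<dots> = real (2 * m) ^ l * (\<Sum>y\<in>walks m k.
      (neighbour_average m ^^ l) f (length (\<one>\<^bsub>free_group (enat m)\<^esub> \<otimes>\<^bsub>free_group (enat m)\<^esub> endpoint y)))"
    using carr by (simp add: sum_distrib_left)
  also have "\<dots> = real (2 * m) ^ (k + l) * (neighbour_average m ^^ (k + l)) f 0"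
    by (subst sum_walks[OF m one_closed]) (simp add: one_free_group power_add funpow_add)
  finally show ?thesis .
qed

text \<open>The family may repeat group elements; this matters because different walks can share
  their endpoint.\<close>

lemma positive_definite_sum:
  assumes pd: "positive_definite G \<phi>" and "finite I" "\<And>i. i \<in> I \<Longrightarrow> g i \<in> carrier G"
  shows "(\<Sum>i\<in>I. \<Sum>j\<in>I. c i * cnj (c j) * \<phi> (inv\<^bsub>G\<^esub> g j \<otimes>\<^bsub>G\<^esub> g i)) \<in> \<real>\<^sub>\<ge>\<^sub>0"
proof -
  obtain h where h: "bij_betw h {..<card I} I"
    using ex_bij_betw_nat_finite[OF \<open>finite I\<close>] by (auto simp: atLeast0LessThan)
  have "(\<Sum>i<card I. \<Sum>j<card I. c (h i) * cnj (c (h j)) * \<phi> (inv\<^bsub>G\<^esub> g (h j) \<otimes>\<^bsub>G\<^esub> g (h i))) \<in> \<real>\<^sub>\<ge>\<^sub>0"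
    using pd[unfolded positive_definite_def, rule_format, of "card I" "g \<circ> h" "c \<circ> h"] assms(3) bij_betwE[OF h]
    by auto
  also have "(\<Sum>i<card I. \<Sum>j<card I. c (h i) * cnj (c (h j)) * \<phi> (inv\<^bsub>G\<^esub> g (h j) \<otimes>\<^bsub>G\<^esub> g (h i)))
      = (\<Sum>i<card I. \<Sum>j\<in>I. c (h i) * cnj (c j) * \<phi> (inv\<^bsub>G\<^esub> g j \<otimes>\<^bsub>G\<^esub> g (h i)))"
    by (intro sum.cong refl sum.reindex_bij_betw[OF h])
  also have "\<dots> = (\<Sum>i\<in>I. \<Sum>j\<in>I. c i * cnj (c j) * \<phi> (inv\<^bsub>G\<^esub> g j \<otimes>\<^bsub>G\<^esub> g i))"
    by (rule sum.reindex_bij_betw[OF h])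
  finally show ?thesis .
qed

text \<open>The test weights spread \<open>d i\<close> uniformly over the (2m)^i walks of length
  \<open>i\<close>. The rank \<open>m\<close> may be smaller than \<open>r\<close>, because products
  and inverses in the smaller group are computed by the same formulas.\<close>

lemma walk_averages_psd:
  assumes m: "1 \<le> m" and mr: "enat m \<le> r" and pd: "positive_definite (free_group r) \<phi>"
    and f: "\<And>x. x \<in> carrier (free_group r) \<Longrightarrow> \<phi> x = of_real (f (length x))"
  shows "0 \<le> (\<Sum>i\<le>N. \<Sum>j\<le>N. d i * d j * (neighbour_average m ^^ (i + j)) f 0)"
proof -
  interpret group "free_group (enat m)" by (rule group_free_group)
  let ?I = "Sigma {..N} (walks m)"
  let ?F = "free_group (enat m)"
  have "letters (enat m) \<subseteq> letters r"
    using mr by (cases r) (auto simp: letters_def)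
  then have sub: "carrier ?F \<subseteq> carrier (free_group r)"
    by (meson carrier_free_group subsetI subset_trans)
  define c where "c p = d (fst p) / real (2 * m) ^ fst p" for p :: "nat \<times> word"
  have carr: "endpoint (snd p) \<in> carrier ?F" if "p \<in> ?I" for p
    using that by (intro endpoint_carrier) (auto simp: walks_def)
  have Sigma_sum: "sum h ?I = (\<Sum>i\<le>N. \<Sum>x\<in>walks m i. h (i, x))" for h :: "nat \<times> word \<Rightarrow> real"
    by (subst sum.Sigma) (auto simp: finite_walks)
  have "(\<Sum>p\<in>?I. \<Sum>p'\<in>?I. of_real (c p) * cnj (of_real (c p')) *
      \<phi> (inv\<^bsub>free_group r\<^esub> endpoint (snd p') \<otimes>\<^bsub>free_group r\<^esub> endpoint (snd p))) \<in> \<real>\<^sub>\<ge>\<^sub>0"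
    using carr sub by (intro positive_definite_sum[OF pd]) (auto intro: finite_walks)
  also have "(\<Sum>p\<in>?I. \<Sum>p'\<in>?I. of_real (c p) * cnj (of_real (c p')) *
      \<phi> (inv\<^bsub>free_group r\<^esub> endpoint (snd p') \<otimes>\<^bsub>free_group r\<^esub> endpoint (snd p)))
    = of_real (\<Sum>p\<in>?I. \<Sum>p'\<in>?I. c p * c p' *
        f (length (inv\<^bsub>?F\<^esub> endpoint (snd p') \<otimes>\<^bsub>?F\<^esub> endpoint (snd p))))"
  proof (unfold of_real_sum, intro sum.cong refl)
    fix p p' assume p: "p \<in> ?I" and p': "p' \<in> ?I"
    have "inv\<^bsub>free_group r\<^esub> endpoint (snd p') \<otimes>\<^bsub>free_group r\<^esub> endpoint (snd p)
        = inv\<^bsub>?F\<^esub> endpoint (snd p') \<otimes>\<^bsub>?F\<^esub> endpoint (snd p)"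
      using carr[OF p'] sub by (auto simp: inv_free_group mult_free_group)
    moreover have "inv\<^bsub>?F\<^esub> endpoint (snd p') \<otimes>\<^bsub>?F\<^esub> endpoint (snd p) \<in> carrier (free_group r)"
      using carr[OF p] carr[OF p'] sub by auto
    ultimately show "of_real (c p) * cnj (of_real (c p')) *
        \<phi> (inv\<^bsub>free_group r\<^esub> endpoint (snd p') \<otimes>\<^bsub>free_group r\<^esub> endpoint (snd p))
      = of_real (c p * c p' * f (length (inv\<^bsub>?F\<^esub> endpoint (snd p') \<otimes>\<^bsub>?F\<^esub> endpoint (snd p))))"
      by (simp add: f)
  qed
  finally have "0 \<le> (\<Sum>p\<in>?I. \<Sum>p'\<in>?I. c p * c p' *
      f (length (inv\<^bsub>?F\<^esub> endpoint (snd p') \<otimes>\<^bsub>?F\<^esub> endpoint (snd p))))"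
    by (simp only: nonneg_Reals_of_real_iff)
  also have "\<dots> = (\<Sum>i\<le>N. \<Sum>x\<in>walks m i. \<Sum>j\<le>N. \<Sum>y\<in>walks m j. c (i, x) * c (j, y) *
      f (length (inv\<^bsub>?F\<^esub> endpoint y \<otimes>\<^bsub>?F\<^esub> endpoint x)))"
    by (simp only: Sigma_sum fst_conv snd_conv)
  also have "\<dots> = (\<Sum>i\<le>N. \<Sum>j\<le>N. \<Sum>x\<in>walks m i. \<Sum>y\<in>walks m j. c (i, x) * c (j, y) *
      f (length (inv\<^bsub>?F\<^esub> endpoint y \<otimes>\<^bsub>?F\<^esub> endpoint x)))"
    by (intro sum.cong refl sum.swap)
  also have "\<dots> = (\<Sum>i\<le>N. \<Sum>j\<le>N. \<Sum>y\<in>walks m j. \<Sum>x\<in>walks m i. c (i, x) * c (j, y) *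
      f (length (inv\<^bsub>?F\<^esub> endpoint y \<otimes>\<^bsub>?F\<^esub> endpoint x)))"
    by (intro sum.cong refl sum.swap)
  also have "\<dots> = (\<Sum>i\<le>N. \<Sum>j\<le>N. d i * d j * (neighbour_average m ^^ (i + j)) f 0)"
  proof (intro sum.cong refl)
    fix i j
    have "(\<Sum>y\<in>walks m j. \<Sum>x\<in>walks m i. c (i, x) * c (j, y) *
        f (length (inv\<^bsub>?F\<^esub> endpoint y \<otimes>\<^bsub>?F\<^esub> endpoint x)))
      = d i / real (2 * m) ^ i * (d j / real (2 * m) ^ j) * (\<Sum>y\<in>walks m j. \<Sum>x\<in>walks m i.
        f (length (inv\<^bsub>?F\<^esub> endpoint y \<otimes>\<^bsub>?F\<^esub> endpoint x)))"
      by (simp add: c_def sum_distrib_left)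
    also have "\<dots> = d i * d j * (neighbour_average m ^^ (i + j)) f 0"
      unfolding sum_walks_pairs[OF m] using m by (simp add: power_add add.commute)
    finally show "(\<Sum>y\<in>walks m j. \<Sum>x\<in>walks m i. c (i, x) * c (j, y) *
        f (length (inv\<^bsub>?F\<^esub> endpoint y \<otimes>\<^bsub>?F\<^esub> endpoint x)))
      = d i * d j * (neighbour_average m ^^ (i + j)) f 0" .
  qed
  finally show ?thesis .
qed

lemma neighbour_average_iterate_tendsto:
  "(\<lambda>m. (neighbour_average m ^^ k) f n) \<longlonglongrightarrow> f (n + k)"
proof (induction k arbitrary: n)
  case (Suc k)
  show ?case
  proof (cases n)
    case 0
    then show ?thesis using Suc[of 1] by (simp add: neighbour_average_def[of _ "(neighbour_average _ ^^ k) f"])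
  next
    case (Suc n')
    have "(\<lambda>m. 1 / real (2 * m) * (neighbour_average m ^^ k) f n'
        + real (2 * m - 1) / real (2 * m) * (neighbour_average m ^^ k) f (Suc (Suc n')))
      \<longlonglongrightarrow> 0 * f (n' + k) + 1 * f (Suc (Suc n') + k)"
      by (intro tendsto_intros Suc.IH) real_asymp+
    moreover have "(neighbour_average m ^^ Suc k) f n = 1 / real (2 * m) * (neighbour_average m ^^ k) f n'
        + real (2 * m - 1) / real (2 * m) * (neighbour_average m ^^ k) f (Suc (Suc n'))" for m
      using Suc by (simp add: neighbour_average_def[of m "(neighbour_average m ^^ k) f"] add_divide_distrib)
    ultimately show ?thesis using Suc by simp
  qed
qed simp

lemma neighbour_average_iterate_bounded:
  assumes m: "1 \<le> m" and f: "\<And>n. \<bar>f n\<bar> \<le> C"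
  shows "\<bar>(neighbour_average m ^^ k) f n\<bar> \<le> C"
proof (induction k arbitrary: n)
  case (Suc k)
  let ?g = "(neighbour_average m ^^ k) f"
  have "\<bar>?g (n - 1) + real (2 * m - 1) * ?g (n + 1)\<bar> \<le> C + real (2 * m - 1) * C"
    using Suc[of "n - 1"] mult_left_mono[OF Suc[of "n + 1"], of "real (2 * m - 1)"]
    by (intro order_trans[OF abs_triangle_ineq]) (simp add: abs_mult)
  also have "\<dots> = real (2 * m) * C" using m by (simp add: algebra_simps)
  finally show ?case
    using Suc[of 1] m by (auto simp: neighbour_average_def[of m ?g] divide_simps mult.commute)
qed (simp add: f)

section \<open>Representing measures\<close>

lemma continuous_on_real_profile [continuous_intros]: "continuous_on A (\<lambda>s. real_profile m s n)"
  by (induction n rule: induct_nat_012) (auto simp: divide_inverse intro!: continuous_intros)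

lemma continuous_on_real_spherical [continuous_intros]: "continuous_on A (\<lambda>s. real_spherical r s n)"
  unfolding real_spherical_def by (cases r) (auto intro!: continuous_intros)

lemma represents_iff:
  assumes "1 \<le> r"
  shows "represents r \<mu> \<phi> \<longleftrightarrow>
    finite_measure \<mu> \<and> sets \<mu> = sets (restrict_space borel {-1..1}) \<and>
    (\<forall>x\<in>carrier (free_group r). \<phi> x = of_real (LINT s|\<mu>. real_spherical r s (length x)))"
  using assms by (auto simp: represents_def spherical_of_real integral_complex_of_real)

lemma ex_word_of_length:
  assumes "1 \<le> r"
  shows "\<exists>x\<in>carrier (free_group r). length x = n"
proof -
  have "reduced_word (replicate n (0, True))"
  proof (induction n)
    case (Suc n)
    then show ?case by (cases n) auto
  qed simp
  moreover have "(0, True) \<in> letters r"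
    using assms by (cases r) (auto simp: letters_def one_enat_def zero_enat_def)
  ultimately show ?thesis
    by (intro bexI[of _ "replicate n (0, True)"]) (auto simp: carrier_free_group)
qed

text \<open>Test at the identity and one word of length \<open>n\<close>, with weights 1 and
  \<plusminus>1. Both off-diagonal entries equal \<open>g n\<close>, since a word and its inverse
  have the same length; so the function is real and not merely Hermitian.\<close>

lemma positive_definite_radial_real:
  assumes r: "1 \<le> r" and radial: "radial r \<phi>" and pd: "positive_definite (free_group r) \<phi>"
  obtains f where "\<And>x. x \<in> carrier (free_group r) \<Longrightarrow> \<phi> x = of_real (f (length x))"
    and "\<And>n. \<bar>f n\<bar> \<le> f 0"
proof -
  obtain w where w: "\<And>n. w n \<in> carrier (free_group r)" "\<And>n. length (w n) = n"
    using ex_word_of_length[OF r] by metis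
  define g where "g n = \<phi> (w n)" for n
  have g: "\<forall>x\<in>carrier (free_group r). \<phi> x = g (length x)"
    using radial w unfolding g_def radial_def by metis
  have Nil: "[] \<in> carrier (free_group r)" by (simp add: carrier_free_group)
  have pos: "2 * g 0 + 2 * e * g n \<in> \<real>\<^sub>\<ge>\<^sub>0" if "e = 1 \<or> e = -1" for e n
  proof -
    have "(\<Sum>j<2::nat. \<Sum>k<2::nat. (if j = 0 then 1 else e) * cnj (if k = 0 then 1 else e) *
        g (tree_dist (if k = 0 then [] else w n) (if j = 0 then [] else w n))) \<in> \<real>\<^sub>\<ge>\<^sub>0"
      using pd[unfolded positive_definite_radial_iff[of r \<phi> g, OF g], rule_format, of 2
          "\<lambda>j. if j = 0 then [] else w n" "\<lambda>j. if j = 0 then 1 else e"] w Nil by auto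
    moreover have "(\<Sum>j<2::nat. \<Sum>k<2::nat. (if j = 0 then 1 else e) * cnj (if k = 0 then 1 else e) *
        g (tree_dist (if k = 0 then [] else w n) (if j = 0 then [] else w n))) = 2 * g 0 + 2 * e * g n"
      using that by (auto simp: numeral_2_eq_2 w)
    ultimately show ?thesis by (simp only:)
  qed
  \<comment> \<open>For \<open>n = 0\<close> the test value is 4 times \<open>g 0\<close>; with that
    imaginary part gone, the other values follow.\<close>
  have "Im (g 0) = 0" using pos[of 1 0] by (simp add: complex_nonneg_Reals_iff)
  then have im: "Im (g n) = 0" for n using pos[of 1 n] by (simp add: complex_nonneg_Reals_iff)
  show ?thesis
  proof (rule that[of "\<lambda>n. Re (g n)"])
    show "\<phi> x = of_real (Re (g (length x)))" if "x \<in> carrier (free_group r)" for x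
      using g that im by (simp add: complex_eq_iff)
    show "\<bar>Re (g n)\<bar> \<le> Re (g 0)" for n
      using pos[of 1 n] pos[of "-1" n] by (simp add: complex_nonneg_Reals_iff abs_le_iff)
  qed
qed

section \<open>Powers of s and spherical functions under the integral\<close>

lemma mult_real_profile:
  assumes "1 \<le> m"
  shows "s * real_profile m s n = neighbour_average m (real_profile m s) n"
proof (cases n)
  case (Suc k)
  have "real (2 * m - 1) \<noteq> 0" using assms by simp
  then show ?thesis
    unfolding Suc neighbour_average_def using assms by (simp add: field_simps del: of_nat_diff)
qed (simp add: neighbour_average_def)

text \<open>Each factor s is traded for one average by the eigenvalue equation. At
  \<open>n = 0\<close> this recovers the moments from the integrals of the profile, as uniqueness
  requires.\<close>

lemma integral_power_real_profile:
  assumes \<mu>: "finite_measure \<mu>" "sets \<mu> = sets (restrict_space borel {-1..1})" and m: "1 \<le> m"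
  shows "(LINT s|\<mu>. s ^ k * real_profile m s n)
    = (neighbour_average m ^^ k) (\<lambda>n. LINT s|\<mu>. real_profile m s n) n"
proof (induction k arbitrary: n)
  case (Suc k)
  have int: "integrable \<mu> (\<lambda>s. s ^ k * real_profile m s j)" for j
    by (intro integrable_continuous_on_interval[OF \<mu>] continuous_intros)
  have "(LINT s|\<mu>. s ^ Suc k * real_profile m s n) = (LINT s|\<mu>. s ^ k * neighbour_average m (real_profile m s) n)"
    by (simp add: mult_real_profile[OF m, symmetric] mult_ac)
  also have "\<dots> = neighbour_average m (\<lambda>j. LINT s|\<mu>. s ^ k * real_profile m s j) n"
    using int by (simp add: neighbour_average_def distrib_left mult.left_commute[of _ "real _"]
        del: of_nat_diff of_nat_mult)
  finally show ?case by (simp add: Suc.IH)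
qed simp

text \<open>The opposite passage, from moments to profile integrals. The free power \<open>k\<close>
  strengthens the induction, because the recurrence for the profile introduces another factor s;
  only \<open>k = 0\<close> is wanted in the end.\<close>

lemma integral_real_profile_of_moments:
  assumes \<mu>: "finite_measure \<mu>" "sets \<mu> = sets (restrict_space borel {-1..1})" and m: "1 \<le> m"
    and mom: "\<And>k. (LINT s|\<mu>. s ^ k) = (neighbour_average m ^^ k) f 0"
  shows "(LINT s|\<mu>. s ^ k * real_profile m s n) = (neighbour_average m ^^ k) f n"
proof (induction n arbitrary: k rule: induct_nat_012)
  case 0
  show ?case by (simp add: mom)
next
  case 1
  have "(LINT s|\<mu>. s ^ k * real_profile m s (Suc 0)) = (LINT s|\<mu>. s ^ Suc k)"
    by (simp add: mult.commute)
  also have "\<dots> = (neighbour_average m ^^ k) f 1"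
    unfolding mom by (simp add: neighbour_average_def[of m "(neighbour_average m ^^ k) f"])
  finally show ?case by simp
next
  case (ge2 n)
  let ?g = "(neighbour_average m ^^ k) f"
  have q: "real (2 * m - 1) \<noteq> 0" using m by simp
  have int: "integrable \<mu> (\<lambda>s. s ^ k * real_profile m s j)" for k j
    by (intro integrable_continuous_on_interval[OF \<mu>] continuous_intros)
  have "(LINT s|\<mu>. s ^ k * real_profile m s (Suc (Suc n)))
      = (LINT s|\<mu>. (real (2 * m) * (s ^ Suc k * real_profile m s (Suc n)) - s ^ k * real_profile m s n) / real (2 * m - 1))"
    by (intro Bochner_Integration.integral_cong refl) (simp add: algebra_simps del: of_nat_diff)
  also have "\<dots> = (real (2 * m) * (LINT s|\<mu>. s ^ Suc k * real_profile m s (Suc n))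
      - (LINT s|\<mu>. s ^ k * real_profile m s n)) / real (2 * m - 1)"
    by (subst integral_divide_zero, subst Bochner_Integration.integral_diff)
      (auto simp: int simp del: power_Suc of_nat_diff)
  also have "\<dots> = (real (2 * m) * neighbour_average m ?g (Suc n) - ?g n) / real (2 * m - 1)"
    by (simp only: ge2 funpow.simps comp_apply)
  also have "\<dots> = ?g (Suc (Suc n))"
    using q m by (simp add: neighbour_average_def[of m ?g] del: of_nat_diff)
  finally show ?case .
qed

lemma represents_moments_eq:
  assumes r: "1 \<le> r" and \<mu>: "represents r \<mu> \<phi>" and \<nu>: "represents r \<nu> \<phi>"
  shows "(LINT s|\<mu>. s ^ k) = (LINT s|\<nu>. s ^ k)"
proof -
  have eq: "(LINT s|\<mu>. real_spherical r s n) = (LINT s|\<nu>. real_spherical r s n)" for n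
    using ex_word_of_length[OF r, of n] \<mu> \<nu> unfolding represents_iff[OF r] by (metis of_real_eq_iff)
  show ?thesis
  proof (cases r)
    case (enat m)
    then have m: "1 \<le> m" using r by (simp add: one_enat_def)
    have "(LINT s|\<kappa>. s ^ k) = (neighbour_average m ^^ k) (\<lambda>n. LINT s|\<kappa>. real_spherical r s n) 0"
      if "represents r \<kappa> \<phi>" for \<kappa>
      using integral_power_real_profile[of \<kappa> m k 0] m that unfolding represents_iff[OF r]
      by (simp add: real_spherical_def enat)
    then show ?thesis using \<mu> \<nu> eq by simp
  next
    case infinity
    then show ?thesis using eq[of k] by (simp add: real_spherical_def)
  qed
qed

section \<open>The two implications and the final equivalence\<close>

lemma positive_definite_if_represents:
  assumes r: "1 \<le> r" and rep: "represents r \<mu> \<phi>"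
  shows "positive_definite (free_group r) \<phi>"
proof -
  have \<mu>: "finite_measure \<mu>" "sets \<mu> = sets (restrict_space borel {-1..1})"
    and \<phi>: "\<forall>x\<in>carrier (free_group r).
      \<phi> x = of_real (LINT s|\<mu>. real_spherical r s (length x))"
    using rep unfolding represents_iff[OF r] by auto
  have space: "space \<mu> = {-1..1}"
    using sets_eq_imp_space_eq[OF \<mu>(2)] by (simp add: space_restrict_space)
  show ?thesis
    unfolding positive_definite_radial_iff[of r \<phi> "\<lambda>n. of_real (LINT s|\<mu>. real_spherical r s n)", OF \<phi>]
  proof (intro allI impI)
    fix n :: nat and x :: "nat \<Rightarrow> word" and c :: "nat \<Rightarrow> complex"
    assume x: "\<forall>j<n. x j \<in> carrier (free_group r)"
    define h where "h s = (\<Sum>j<n. \<Sum>k<n. c j * cnj (c k) *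
      complex_of_real (real_spherical r s (tree_dist (x k) (x j))))" for s
    have h: "h s \<in> \<real>\<^sub>\<ge>\<^sub>0" if "s \<in> space \<mu>" for s
      unfolding h_def using that space x by (intro real_spherical_kernel[OF r]) (auto simp: abs_le_iff)
    have int: "integrable \<mu> (\<lambda>s. complex_of_real (real_spherical r s d))" for d
      by (intro integrable_continuous_on_interval[OF \<mu>] continuous_intros)
    have "(\<Sum>j<n. \<Sum>k<n. c j * cnj (c k) * of_real (LINT s|\<mu>. real_spherical r s (tree_dist (x k) (x j))))
        = (LINT s|\<mu>. h s)"
      unfolding h_def
      by (simp add: Bochner_Integration.integral_sum Bochner_Integration.integrable_sum int integral_complex_of_real[symmetric]
          del: integral_complex_of_real)
    \<comment> \<open>The integrand is real and nonnegative on [-1,1]; replacing it by its real part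
      reduces the claim to positivity of a real integral.\<close>
    also have "\<dots> = (LINT s|\<mu>. of_real (Re (h s)))"
      using h by (intro Bochner_Integration.integral_cong refl) (simp add: complex_nonneg_Reals_iff complex_eq_iff)
    also have "\<dots> \<in> \<real>\<^sub>\<ge>\<^sub>0"
      unfolding integral_complex_of_real nonneg_Reals_of_real_iff
      using h by (intro Bochner_Integration.integral_nonneg) (simp add: complex_nonneg_Reals_iff)
    finally show "(\<Sum>j<n. \<Sum>k<n. c j * cnj (c k) *
        of_real (LINT s|\<mu>. real_spherical r s (tree_dist (x k) (x j)))) \<in> \<real>\<^sub>\<ge>\<^sub>0" .
  qed
qed

lemma represents_if_positive_definite:
  assumes r: "1 \<le> r" and radial: "radial r \<phi>" and pd: "positive_definite (free_group r) \<phi>"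
  shows "\<exists>\<mu>. represents r \<mu> \<phi>"
proof -
  obtain f where f: "\<And>x. x \<in> carrier (free_group r) \<Longrightarrow> \<phi> x = of_real (f (length x))"
      and bdd: "\<And>n. \<bar>f n\<bar> \<le> f 0"
    using positive_definite_radial_real[OF r radial pd] by blast
  have "\<exists>\<mu>. finite_measure \<mu> \<and> sets \<mu> = sets (restrict_space borel {-1..1}) \<and>
      (\<forall>n. (LINT s|\<mu>. real_spherical r s n) = f n)"
  proof (cases r)
    case (enat m)
    then have m: "1 \<le> m" using r by (simp add: one_enat_def)
    interpret bounded_hankel "\<lambda>k. (neighbour_average m ^^ k) f 0"
    proof
      show "0 \<le> (\<Sum>i\<le>N. \<Sum>j\<le>N. d i * d j * (neighbour_average m ^^ (i + j)) f 0)" for N d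
        by (rule walk_averages_psd[OF m _ pd f]) (simp_all add: enat)
      show "\<bar>(neighbour_average m ^^ n) f 0\<bar> \<le> (neighbour_average m ^^ 0) f 0" for n
        using neighbour_average_iterate_bounded[OF m bdd] by simp
    qed
    obtain \<mu> where "finite_measure \<mu>" "sets \<mu> = sets (restrict_space borel {-1..1})"
        "\<And>n. (LINT s|\<mu>. s ^ n) = (neighbour_average m ^^ n) f 0"
      using ex_moment_measure by blast
    then show ?thesis
      using integral_real_profile_of_moments[of \<mu> m f 0] m by (auto simp: real_spherical_def enat)
  next
    case infinity
    \<comment> \<open>In infinite rank the profile integrals are the moments themselves, so the
      Hankel condition is needed for \<open>f\<close> directly.\<close>
    interpret bounded_hankel f
    proof
      fix N and d :: "nat \<Rightarrow> real"
      show "0 \<le> (\<Sum>i\<le>N. \<Sum>j\<le>N. d i * d j * f (i + j))"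
      proof (rule LIMSEQ_le_const)
        show "(\<lambda>m. \<Sum>i\<le>N. \<Sum>j\<le>N. d i * d j * (neighbour_average m ^^ (i + j)) f 0)
            \<longlonglongrightarrow> (\<Sum>i\<le>N. \<Sum>j\<le>N. d i * d j * f (i + j))"
          by (intro tendsto_intros neighbour_average_iterate_tendsto[of _ _ 0, simplified])
        show "\<exists>M. \<forall>m\<ge>M. 0 \<le> (\<Sum>i\<le>N. \<Sum>j\<le>N. d i * d j * (neighbour_average m ^^ (i + j)) f 0)"
          by (intro exI[of _ 1] allI impI walk_averages_psd[OF _ _ pd f]) (simp_all add: infinity)
      qed
    qed (rule bdd)
    show ?thesis
      using ex_moment_measure by (simp add: real_spherical_def infinity)
  qed
  then show ?thesis unfolding represents_iff[OF r] using f by auto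
qed

theorem theorem1p1:
  fixes r :: enat and \<phi> :: "word \<Rightarrow> complex"
  assumes "2 \<le> r" and "radial r \<phi>"
  shows "(positive_definite (free_group r) \<phi> \<longleftrightarrow> (\<exists>\<mu>. represents r \<mu> \<phi>)) \<and>
    (\<forall>\<mu>. represents r \<mu> \<phi> \<longrightarrow>
       (\<forall>\<nu>. represents r \<nu> \<phi> \<longrightarrow> \<nu> = \<mu>) \<and>
       \<phi> \<one>\<^bsub>free_group r\<^esub> = of_real (measure \<mu> {-1..1}))"
proof (intro conjI allI impI)
  have r: "1 \<le> r" using \<open>2 \<le> r\<close> by (rule order_trans[rotated]) simp
  show "positive_definite (free_group r) \<phi> \<longleftrightarrow> (\<exists>\<mu>. represents r \<mu> \<phi>)"
    using represents_if_positive_definite[OF r assms(2)] positive_definite_if_represents[OF r] by blast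
  fix \<mu> assume \<mu>: "represents r \<mu> \<phi>"
  show "\<nu> = \<mu>" if \<nu>: "represents r \<nu> \<phi>" for \<nu>
    using \<mu> \<nu> represents_moments_eq[OF r \<nu> \<mu>] unfolding represents_iff[OF r]
    by (intro measure_eqI_moments) auto
  have "space \<mu> = {-1..1}"
    using \<mu> sets_eq_imp_space_eq[of \<mu> "restrict_space borel {-1..1}"]
    by (simp add: represents_def space_restrict_space)
  moreover have "\<phi> [] = of_real (LINT s|\<mu>. real_spherical r s 0)"
    using \<mu> by (simp add: represents_iff[OF r] carrier_free_group)
  moreover have "real_spherical r s 0 = 1" for s by (cases r) (simp_all add: real_spherical_def)
  ultimately show "\<phi> \<one>\<^bsub>free_group r\<^esub> = of_real (measure \<mu> {-1..1})"
    by (simp add: one_free_group)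
qed

end
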